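(* Let $0=d_0<d_1<\dots<d_s<d_{s+1}=n+1$ be integers, $\mathbf{d}=(d_1,\dots,d_s)$, and let $\mathcal{F}^a_{\mathbf{d}}\simeq\mathrm{Gr}_{\mathbf{dim}\,P}(P\oplus I)$ be the degenerate partial flag variety, realized as the quiver Grassmannian for $P=\bigoplus_{i=1}^sP_i^{d_i-d_{i-1}}$, $I=\bigoplus_{i=1}^sI_i^{d_{i+1}-d_i}$ over the equioriented quiver of type $A_s$. Let $G$ be the group acting on $\mathcal{F}^a_{\mathbf{d}}$ as described in the context. Let $L^1,\dots,L^s$ be subsets of $\{1,\dots,n+1\}$ with $\#L^i=d_i$ such that the torus fixed point $p_{L^1,\dots,L^s}=\prod_{i=1}^sp_{L^i}$ lies in $\mathcal{F}^a_{\mathbf{d}}$. Then the orbit $G\cdot p_{L^1,\dots,L^s}$ is the intersection of $\mathrm{Gr}_{\mathbf{dim}\,P}(P\oplus I)$ with the product of cells $C_{L^i}$: $$G\cdot p_{L^1,\dots,L^s}=\mathcal{F}^a_{\mathbf{d}}\cap\prod_{i=1}^sC_{L^i}.$$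
   Context: Let $W$ be an $(n+1)$-dimensional complex vector space with basis $w_1,\dots,w_{n+1}$, and $pr_k(\sum_ic_iw_i)=\sum_{i\ne k}c_iw_i$. $\mathcal{F}^a_{\mathbf{d}}\subset\prod_{i=1}^s\mathrm{Gr}_{d_i}(W)$ is the variety of collections $(V_i)_{i=1}^s$, $\dim V_i=d_i$, with $pr_{d_i+1}\cdots pr_{d_{i+1}}V_i\subset V_{i+1}$ for $1\le i\le s-1$. It is isomorphic to the quiver Grassmannian in the claim ($P_i,I_i$ being the indecomposable projectives and injectives of the equioriented $A_s$ quiver with arrows $i\to i+1$), by identifying each $(P\oplus I)_j$ with $W$ so that the map of the arrow $j\to j+1$ becomes $pr_{d_j+1}\cdots pr_{d_{j+1}}$. The group $G$: let $Q$ be the equioriented quiver of type $A_n$ (vertices $1,\dots,n$, arrows $i\to i+1$), $\hat P=\bigoplus_{i=1}^n\hat P_i$, $\hat I=\bigoplus_{i=1}^n\hat I_i$ the direct sums of its indecomposable projectives and injectives, each once, and $G=\begin{bmatrix}\mathrm{Aut}_Q(\hat P)&0\\ \mathrm{Hom}_Q(\hat P,\hat I)&\mathrm{Aut}_Q(\hat I)\end{bmatrix}$. Choose bases: $w_{i,j}\in(\hat P_j)_i$ for $1\le j\le i$ and $w_{i,j+1}\in(\hat I_j)_i$ for $i\le j\le n$, such that the arrow $i\to i+1$ maps $w_{i,j}\mapsto w_{i+1,j}$ for $j\ne i+1$ and $w_{i,i+1}\mapsto0$. Identify $(\hat P\oplus\hat I)_i$ with $W$ by $w_{i,j}\mapsto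 w_j$; then the map of the arrow $i\to i+1$ is $pr_{i+1}$. An element $g=(g_i)_{i=1}^n\in G$ acts on $\mathcal{F}^a_{\mathbf{d}}$ by $(V_i)_{i=1}^s\mapsto(g_{d_i}V_i)_{i=1}^s$. For $L=\{l_1<\dots<l_d\}\subset\{1,\dots,n+1\}$, $p_L\in\mathrm{Gr}_d(W)$ is the span of $w_{l_1},\dots,w_{l_d}$. Let $k$ be such that $l_k\le d<l_{k+1}$ (with $k=0$ if all $l_j>d$, and $k=d$ if all $l_j\le d$). The cell $C_L\subset\mathrm{Gr}_d(W)$ consists of the $d$-dimensional subspaces having a basis $e_1,\dots,e_d$ of the form $$e_j=w_{l_j}+\sum_{p=1}^{l_j-1}c_pw_p+\sum_{p=d+1}^{n+1}c_pw_p\quad(1\le j\le k),\qquad e_j=w_{l_j}+\sum_{p=d+1}^{l_j-1}c_pw_p\quad(k+1\le j\le d),$$ for some constants $c_p$ (depending on $j$). *)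

theory Defs
  imports Complex_Main "HOL-Library.Function_Algebras" "HOL-Library.FuncSet"
begin

section \<open>Coordinate vector spaces\<close>

definition cscale :: "complex \<Rightarrow> ('b \<Rightarrow> complex) \<Rightarrow> 'b \<Rightarrow> complex" where
  "cscale c v = (\<lambda>x. c * v x)"

global_interpretation cfun: vector_space "cscale :: complex \<Rightarrow> ('b \<Rightarrow> complex) \<Rightarrow> 'b \<Rightarrow> complex"
  by unfold_locales (auto simp: cscale_def fun_eq_iff algebra_simps)

text \<open>The space \<open>W\<close> of dimension \<open>n + 1\<close> consists of the functions on \<open>nat\<close> that vanish
  outside \<open>{1..n + 1}\<close>; its basis vectors are \<open>basis_w 1, \<dots>, basis_w (n + 1)\<close>.\<close>

definition space_W :: "nat \<Rightarrow> (nat \<Rightarrow> complex) set" where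
  "space_W n = {v. \<forall>l. l \<notin> {1..n + 1} \<longrightarrow> v l = 0}"

definition basis_w :: "nat \<Rightarrow> nat \<Rightarrow> complex" where
  "basis_w k = (\<lambda>l. if l = k then 1 else 0)"

definition pr :: "nat \<Rightarrow> (nat \<Rightarrow> complex) \<Rightarrow> nat \<Rightarrow> complex" where
  "pr k v = v(k := 0)"

definition subspaces :: "nat \<Rightarrow> ('b \<Rightarrow> complex) set \<Rightarrow> ('b \<Rightarrow> complex) set set" where
  "subspaces k U = {V. cfun.subspace V \<and> V \<subseteq> U \<and> cfun.dim V = k}"

section \<open>The degenerate partial flag variety\<close>

text \<open>Collections \<open>(V\<^sub>1, \<dots>, V\<^sub>s)\<close> are extensional functions on \<open>{1..s}\<close>. The term
  \<open>foldr pr [a + 1..<b + 1]\<close> is the composite of \<open>pr (a + 1), \<dots>, pr b\<close>.\<close>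

definition degenerate_flags ::
  "nat \<Rightarrow> nat \<Rightarrow> (nat \<Rightarrow> nat) \<Rightarrow> (nat \<Rightarrow> (nat \<Rightarrow> complex) set) set" where
  "degenerate_flags n s d =
    {V \<in> (\<Pi>\<^sub>E i\<in>{1..s}. subspaces (d i) (space_W n)).
      \<forall>i\<in>{1..<s}. foldr pr [d i + 1..<d (i + 1) + 1] ` V i \<subseteq> V (i + 1)}"

section \<open>Representations of the equioriented quiver of type A\<close>

text \<open>A representation consists of a space for each vertex \<open>i\<close> and a map for each arrow
  \<open>i \<rightarrow> i + 1\<close>. The number \<open>s\<close> of vertices is not part of the data: only the spaces at
  \<open>1, \<dots>, s\<close> and the maps at \<open>1, \<dots>, s - 1\<close> matter, and the notions below that refer
  to the whole quiver take \<open>s\<close> as an argument. Maps matter only on the given spaces.\<close>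

record 'v rep =
  space :: "nat \<Rightarrow> 'v set"
  arrow :: "nat \<Rightarrow> 'v \<Rightarrow> 'v"

definition proj_rep :: "nat \<Rightarrow> complex rep" where
  "proj_rep i = \<lparr>space = (\<lambda>j. if i \<le> j then UNIV else {0}),
                 arrow = (\<lambda>j x. if i \<le> j then x else 0)\<rparr>"

definition inj_rep :: "nat \<Rightarrow> complex rep" where
  "inj_rep i = \<lparr>space = (\<lambda>j. if j \<le> i then UNIV else {0}),
                arrow = (\<lambda>j x. if j + 1 \<le> i then x else 0)\<rparr>"

definition direct_sum :: "'b set \<Rightarrow> ('b \<Rightarrow> complex rep) \<Rightarrow> ('b \<Rightarrow> complex) rep" where
  "direct_sum S M =
    \<lparr>space = (\<lambda>j. {v. (\<forall>l\<in>S. v l \<in> space (M l) j) \<and> (\<forall>l. l \<notin> S \<longrightarrow> v l = 0)}),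
     arrow = (\<lambda>j v l. if l \<in> S then arrow (M l) j (v l) else 0)\<rparr>"

definition rep_plus ::
  "('a \<Rightarrow> complex) rep \<Rightarrow> ('b \<Rightarrow> complex) rep \<Rightarrow> ('a + 'b \<Rightarrow> complex) rep" where
  "rep_plus M N =
    \<lparr>space = (\<lambda>j. {v. v \<circ> Inl \<in> space M j \<and> v \<circ> Inr \<in> space N j}),
     arrow = (\<lambda>j v. case_sum (arrow M j (v \<circ> Inl)) (arrow N j (v \<circ> Inr)))\<rparr>"

definition rep_hom :: "nat \<Rightarrow> ('a \<Rightarrow> complex) rep \<Rightarrow> ('b \<Rightarrow> complex) rep \<Rightarrow>
    (nat \<Rightarrow> ('a \<Rightarrow> complex) \<Rightarrow> 'b \<Rightarrow> complex) set" where
  "rep_hom s M N = {f.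
    (\<forall>j\<in>{1..s}. f j \<in> space M j \<rightarrow> space N j \<and>
      (\<forall>u\<in>space M j. \<forall>v\<in>space M j. f j (u + v) = f j u + f j v) \<and>
      (\<forall>c. \<forall>v\<in>space M j. f j (cscale c v) = cscale c (f j v))) \<and>
    (\<forall>j\<in>{1..<s}. \<forall>v\<in>space M j. f (j + 1) (arrow M j v) = arrow N j (f j v))}"

definition rep_aut :: "nat \<Rightarrow> ('a \<Rightarrow> complex) rep \<Rightarrow>
    (nat \<Rightarrow> ('a \<Rightarrow> complex) \<Rightarrow> 'a \<Rightarrow> complex) set" where
  "rep_aut s M = {f \<in> rep_hom s M M. \<forall>j\<in>{1..s}. bij_betw (f j) (space M j) (space M j)}"

definition quiver_grassmannian ::
  "nat \<Rightarrow> (nat \<Rightarrow> nat) \<Rightarrow> ('b \<Rightarrow> complex) rep \<Rightarrow> (nat \<Rightarrow> ('b \<Rightarrow> complex) set) set" where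
  "quiver_grassmannian s e M =
    {N \<in> (\<Pi>\<^sub>E j\<in>{1..s}. subspaces (e j) (space M j)).
      \<forall>j\<in>{1..<s}. arrow M j ` N j \<subseteq> N (j + 1)}"

definition dim_vector :: "('b \<Rightarrow> complex) rep \<Rightarrow> nat \<Rightarrow> nat" where
  "dim_vector M j = cfun.dim (space M j)"

section \<open>The degenerate partial flag variety as a quiver Grassmannian\<close>

text \<open>The summands are indexed by the basis vectors of \<open>W\<close> they are going to be identified with:
  the indices \<open>l\<close> with \<open>d (i - 1) < l \<le> d i\<close>, that is \<open>block d l = i\<close>, are those of the
  \<open>d i - d (i - 1)\<close> copies of the projective at \<open>i\<close> and of the copies of the injective
  at \<open>i - 1\<close>.\<close>

definition block :: "(nat \<Rightarrow> nat) \<Rightarrow> nat \<Rightarrow> nat" where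
  "block d l = (LEAST i. l \<le> d i)"

definition flag_P :: "nat \<Rightarrow> (nat \<Rightarrow> nat) \<Rightarrow> (nat \<Rightarrow> complex) rep" where
  "flag_P s d = direct_sum {1..d s} (\<lambda>l. proj_rep (block d l))"

definition flag_I :: "nat \<Rightarrow> (nat \<Rightarrow> nat) \<Rightarrow> (nat \<Rightarrow> complex) rep" where
  "flag_I s d = direct_sum {d 1 + 1..d (s + 1)} (\<lambda>l. inj_rep (block d l - 1))"

text \<open>At each vertex, the identification of \<open>P \<oplus> I\<close> with \<open>W\<close> sends the basis vector
  of the summand with index \<open>l\<close> to \<open>basis_w l\<close>.\<close>

definition to_W :: "(nat + nat \<Rightarrow> complex) \<Rightarrow> nat \<Rightarrow> complex" where
  "to_W v = (\<lambda>l. v (Inl l) + v (Inr l))"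

definition flag_grassmannian ::
  "nat \<Rightarrow> (nat \<Rightarrow> nat) \<Rightarrow> (nat \<Rightarrow> (nat \<Rightarrow> complex) set) set" where
  "flag_grassmannian s d =
    (\<lambda>N. \<lambda>j\<in>{1..s}. to_W ` N j) `
      quiver_grassmannian s (dim_vector (flag_P s d)) (rep_plus (flag_P s d) (flag_I s d))"

section \<open>The group and its action\<close>

text \<open>As before, the summands are indexed so that the basis vector \<open>w\<^sub>i\<^sub>,\<^sub>l\<close> at the vertex \<open>i\<close>
  lies in the summand with index \<open>l\<close>, which for the injectives is the one at the vertex
  \<open>l - 1\<close>.\<close>

definition hat_P :: "nat \<Rightarrow> (nat \<Rightarrow> complex) rep" where
  "hat_P n = direct_sum {1..n} proj_rep"

definition hat_I :: "nat \<Rightarrow> (nat \<Rightarrow> complex) rep" where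
  "hat_I n = direct_sum {2..n + 1} (\<lambda>l. inj_rep (l - 1))"

definition block_matrix :: "(nat \<Rightarrow> ('a \<Rightarrow> complex) \<Rightarrow> 'a \<Rightarrow> complex) \<Rightarrow>
    (nat \<Rightarrow> ('a \<Rightarrow> complex) \<Rightarrow> 'b \<Rightarrow> complex) \<Rightarrow> (nat \<Rightarrow> ('b \<Rightarrow> complex) \<Rightarrow> 'b \<Rightarrow> complex) \<Rightarrow>
    nat \<Rightarrow> ('a + 'b \<Rightarrow> complex) \<Rightarrow> 'a + 'b \<Rightarrow> complex" where
  "block_matrix a h b i v = case_sum (a i (v \<circ> Inl)) (h i (v \<circ> Inl) + b i (v \<circ> Inr))"

definition group_G :: "nat \<Rightarrow> (nat \<Rightarrow> (nat + nat \<Rightarrow> complex) \<Rightarrow> nat + nat \<Rightarrow> complex) set" where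
  "group_G n = {block_matrix a h b | a h b.
    a \<in> rep_aut n (hat_P n) \<and> h \<in> rep_hom n (hat_P n) (hat_I n) \<and> b \<in> rep_aut n (hat_I n)}"

text \<open>The image of \<open>U \<subseteq> W\<close> under the component of \<open>g\<close> at the vertex \<open>i\<close>, transported to
  \<open>W\<close> along the identification.\<close>

definition act_at :: "nat \<Rightarrow> (nat \<Rightarrow> (nat + nat \<Rightarrow> complex) \<Rightarrow> nat + nat \<Rightarrow> complex) \<Rightarrow>
    nat \<Rightarrow> (nat \<Rightarrow> complex) set \<Rightarrow> (nat \<Rightarrow> complex) set" where
  "act_at n g i U = to_W ` g i ` {v \<in> space (rep_plus (hat_P n) (hat_I n)) i. to_W v \<in> U}"

definition orbit :: "nat \<Rightarrow> nat \<Rightarrow> (nat \<Rightarrow> nat) \<Rightarrow> (nat \<Rightarrow> (nat \<Rightarrow> complex) set) \<Rightarrow>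
    (nat \<Rightarrow> (nat \<Rightarrow> complex) set) set" where
  "orbit n s d V = (\<lambda>g. \<lambda>i\<in>{1..s}. act_at n g (d i) (V i)) ` group_G n"

section \<open>Torus fixed points and cells\<close>

definition coord_subspace :: "nat set \<Rightarrow> (nat \<Rightarrow> complex) set" where
  "coord_subspace L = cfun.span (basis_w ` L)"

definition fixed_point :: "nat \<Rightarrow> (nat \<Rightarrow> nat set) \<Rightarrow> nat \<Rightarrow> (nat \<Rightarrow> complex) set" where
  "fixed_point s L = (\<lambda>i\<in>{1..s}. coord_subspace (L i))"

text \<open>\<open>elt L j\<close> is \<open>l\<^sub>j\<close> for \<open>L = {l\<^sub>1 < \<dots> < l\<^sub>d}\<close>.\<close>

definition elt :: "nat set \<Rightarrow> nat \<Rightarrow> nat" where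
  "elt L j = sorted_list_of_set L ! (j - 1)"

definition cell :: "nat \<Rightarrow> nat \<Rightarrow> nat set \<Rightarrow> (nat \<Rightarrow> complex) set set" where
  "cell n d L = {V \<in> subspaces d (space_W n). \<exists>k e c. k \<le> d \<and>
    (\<forall>j\<in>{1..k}. elt L j \<le> d) \<and> (\<forall>j\<in>{k + 1..d}. d < elt L j) \<and>
    inj_on e {1..d} \<and> cfun.independent (e ` {1..d}) \<and> cfun.span (e ` {1..d}) = V \<and>
    (\<forall>j\<in>{1..k}. e j = basis_w (elt L j) + (\<Sum>p\<in>{1..<elt L j}. cscale (c j p) (basis_w p))
                                  + (\<Sum>p\<in>{d + 1..n + 1}. cscale (c j p) (basis_w p))) \<and>
    (\<forall>j\<in>{k + 1..d}. e j = basis_w (elt L j) + (\<Sum>p\<in>{d + 1..<elt L j}. cscale (c j p) (basis_w p)))}"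

end

theory Submission
  imports Defs
begin

text \<open>Transported to \<open>W\<close>, the component \<open>g\<^sub>i\<close> of an element of the group at the vertex \<open>i\<close> is an
  invertible matrix that is triangular for the order \<open>i + 1 < \<dots> < n + 1 < 1 < \<dots> < i\<close> of the basis
  (\<open>T_triangular\<close>, \<open>T_diagonal\<close>). For \<open>i = d\<close> this is the order whose Schubert cells are the
  cells \<open>C\<^sub>L\<close> of subspaces of dimension \<open>d\<close>: a subspace \<open>V\<close> of dimension \<open>d\<close> lies in \<open>C\<^sub>L\<close>
  exactly if for each \<open>l \<in> L\<close> it contains a vector with leading term \<open>w\<^sub>l\<close> (\<open>cell_iff\<close>). Hence the orbit of the fixed point is contained in the product of
  the cells; it is contained in the flag variety because the fixed point lies in it and \<open>g\<close> commutes
  with the projections (\<open>T_proj_on\<close>).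

  Conversely, let \<open>V\<close> be a point of the flag variety in the product of the cells. A group element is
  a choice of columns: for each \<open>l \<le> n\<close> the image of the generator of the \<open>l\<close>-th projective, and for
  each \<open>l \<ge> 2\<close> a column for the injective summand of index \<open>l\<close>. The columns are independent of each
  other, and at the vertex \<open>i\<close> the image of \<open>w\<^sub>l\<close> is a projection of the first column if \<open>l \<le> i\<close>, and
  of the second if \<open>l > i\<close>. It remains to find columns such that the image of \<open>w\<^sub>l\<close> at the vertex
  \<open>d t\<close> lies in \<open>V t\<close> for all \<open>t\<close> with \<open>l \<in> L t\<close>. For each of the two columns of \<open>l\<close>, take the first
  \<open>t\<close> at which it is asked for, and let it be a vector of \<open>V t\<close> with leading term \<open>w\<^sub>l\<close>; at the later
  vertices its projections lie in the right spaces because \<open>V\<close> is a flag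
  (\<open>projective_column_exists\<close>, \<open>injective_column_exists\<close>). The resulting \<open>g\<close> maps the fixed point
  into \<open>V\<close>, and onto it by dimension.\<close>

section \<open>Coordinate subspaces and triangular families\<close>

interpretation cfun_pair: vector_space_pair
    "cscale :: complex \<Rightarrow> ('b \<Rightarrow> complex) \<Rightarrow> 'b \<Rightarrow> complex"
    "cscale :: complex \<Rightarrow> ('c \<Rightarrow> complex) \<Rightarrow> 'c \<Rightarrow> complex"
  by unfold_locales

abbreviation clinear :: "(('b \<Rightarrow> complex) \<Rightarrow> 'c \<Rightarrow> complex) \<Rightarrow> bool" where
  "clinear \<equiv> Vector_Spaces.linear cscale cscale"

lemma cscale_apply [simp]: "cscale c v x = c * v x"
  by (simp add: cscale_def)

lemma sum_fun_apply: "(\<Sum>i\<in>A. f i) x = (\<Sum>i\<in>A. f i x)"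
  for f :: "'i \<Rightarrow> 'b \<Rightarrow> complex"
  by (induction A rule: infinite_finite_induct) auto

lemma clinearI:
  assumes "\<And>x y. f (x + y) = f x + f y" and "\<And>c x. f (cscale c x) = cscale c (f x)"
  shows "clinear f"
  using assms by unfold_locales auto

lemma basis_w_apply: "basis_w k l = (if l = k then 1 else 0)"
  by (simp add: basis_w_def)

lemma sum_basis_w_apply:
  assumes "finite A"
  shows "(\<Sum>p\<in>A. cscale (c p) (basis_w p)) x = (if x \<in> A then c x else 0)"
  using assms by (simp add: sum_fun_apply basis_w_apply if_distrib sum.delta' cong: if_cong)

definition supported :: "nat set \<Rightarrow> (nat \<Rightarrow> complex) set" where
  "supported S = {x. \<forall>l. l \<notin> S \<longrightarrow> x l = 0}"

definition proj_on :: "nat set \<Rightarrow> (nat \<Rightarrow> complex) \<Rightarrow> nat \<Rightarrow> complex" where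
  "proj_on S x = (\<lambda>l. if l \<in> S then x l else 0)"

lemma proj_on_apply: "proj_on S x l = (if l \<in> S then x l else 0)"
  by (simp add: proj_on_def)

lemma proj_on_supported [simp]: "proj_on S x \<in> supported S"
  by (simp add: proj_on_def supported_def)

lemma proj_on_eq_self: "x \<in> supported S \<Longrightarrow> S \<subseteq> T \<Longrightarrow> proj_on T x = x"
  by (auto simp: proj_on_def supported_def fun_eq_iff)

lemma proj_on_add: "proj_on S (x + y) = proj_on S x + proj_on S y"
  by (auto simp: proj_on_def)

lemma proj_on_cscale: "proj_on S (cscale c x) = cscale c (proj_on S x)"
  by (auto simp: proj_on_def)

lemma supported_mono: "S \<subseteq> T \<Longrightarrow> supported S \<subseteq> supported T"
  by (auto simp: supported_def)

lemma space_W_supported: "space_W n = supported {1..n + 1}"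
  by (simp add: space_W_def supported_def)

lemma zero_supported: "0 \<in> supported S"
  by (simp add: supported_def)

lemma subspace_supported: "cfun.subspace (supported S)"
  by (auto simp: cfun.subspace_def supported_def)

lemma supported_expansion:
  assumes "finite S" and "x \<in> supported S"
  shows "x = (\<Sum>l\<in>S. cscale (x l) (basis_w l))"
  using assms by (auto simp: fun_eq_iff sum_basis_w_apply supported_def)

lemma basis_w_supported: "l \<in> S \<Longrightarrow> basis_w l \<in> supported S"
  by (auto simp: supported_def basis_w_def)

lemma supported_eq_span:
  assumes "finite S" shows "supported S = cfun.span (basis_w ` S)"
proof
  show "supported S \<subseteq> cfun.span (basis_w ` S)"
  proof
    fix x assume "x \<in> supported S"
    then have "x = (\<Sum>l\<in>S. cscale (x l) (basis_w l))"
      using supported_expansion assms by blast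
    also have "\<dots> \<in> cfun.span (basis_w ` S)"
      by (intro cfun.span_sum cfun.span_scale cfun.span_base) auto
    finally show "x \<in> cfun.span (basis_w ` S)" .
  qed
  show "cfun.span (basis_w ` S) \<subseteq> supported S"
    by (intro cfun.span_minimal subspace_supported) (auto intro: basis_w_supported)
qed

text \<open>Among the indices with a non-zero coefficient take the one of highest rank, and evaluate the
  linear combination there.\<close>
lemma triangular_scalars_zero:
  fixes \<rho> :: "nat \<Rightarrow> nat" and E :: "nat \<Rightarrow> nat \<Rightarrow> complex"
  assumes fin: "finite S" and inj: "inj_on \<rho> S"
    and diag: "\<And>l. l \<in> S \<Longrightarrow> E l l \<noteq> 0"
    and tri: "\<And>l m. l \<in> S \<Longrightarrow> m \<in> S \<Longrightarrow> \<rho> l < \<rho> m \<Longrightarrow> E l m = 0"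
    and zero: "(\<Sum>l\<in>S. cscale (u l) (E l)) = 0" and "l \<in> S"
  shows "u l = 0"
proof (rule ccontr)
  assume "u l \<noteq> 0"
  define N where "N = {m \<in> S. u m \<noteq> 0}"
  have "finite N" "N \<noteq> {}"
    using fin \<open>l \<in> S\<close> \<open>u l \<noteq> 0\<close> by (auto simp: N_def)
  then have "Max (\<rho> ` N) \<in> \<rho> ` N"
    by (intro Max_in) auto
  then obtain m where "m \<in> N" "\<rho> m = Max (\<rho> ` N)"
    by (metis imageE)
  then have m: "m \<in> N" "\<And>k. k \<in> N \<Longrightarrow> \<rho> k \<le> \<rho> m"
    using \<open>finite N\<close> by auto
  have mS: "m \<in> S" "u m \<noteq> 0"
    using m(1) by (auto simp: N_def)
  have "u k * E k m = 0" if "k \<in> S - {m}" for k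
  proof (cases "u k = 0")
    case False
    then have "\<rho> k \<le> \<rho> m" "\<rho> k \<noteq> \<rho> m"
      using that m(2)[of k] inj mS by (auto simp: N_def inj_on_def)
    then show ?thesis
      using that tri[of k m] mS by auto
  qed simp
  then have "(\<Sum>k\<in>S. u k * E k m) = u m * E m m"
    using fin mS by (simp only: sum.remove[of S m]) (simp add: sum.neutral)
  moreover have "(\<Sum>k\<in>S. u k * E k m) = 0"
    using fun_cong[OF zero, of m] by (simp add: sum_fun_apply)
  ultimately show False
    using diag mS by simp
qed

lemma triangular_independent:
  fixes \<rho> :: "nat \<Rightarrow> nat" and E :: "nat \<Rightarrow> nat \<Rightarrow> complex"
  assumes fin: "finite S" and inj: "inj_on \<rho> S"
    and diag: "\<And>l. l \<in> S \<Longrightarrow> E l l \<noteq> 0"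
    and tri: "\<And>l m. l \<in> S \<Longrightarrow> m \<in> S \<Longrightarrow> \<rho> l < \<rho> m \<Longrightarrow> E l m = 0"
  shows "inj_on E S" and "cfun.independent (E ` S)"
proof -
  show inj_E: "inj_on E S"
  proof (rule inj_onI, rule ccontr)
    fix l m assume lm: "l \<in> S" "m \<in> S" "E l = E m" "l \<noteq> m"
    then have "\<rho> l \<noteq> \<rho> m"
      using inj by (auto simp: inj_on_def)
    then consider "\<rho> l < \<rho> m" | "\<rho> m < \<rho> l" by linarith
    then show False
      using tri[of l m] tri[of m l] diag[of l] diag[of m] lm by cases auto
  qed
  show "cfun.independent (E ` S)"
  proof (rule cfun.independent_if_scalars_zero)
    show "finite (E ` S)" using fin by simp
    fix f x assume 0: "(\<Sum>x\<in>E ` S. cscale (f x) x) = 0" and "x \<in> E ` S"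
    then obtain l where "l \<in> S" "x = E l" by blast
    moreover have "(\<Sum>l\<in>S. cscale (f (E l)) (E l)) = 0"
      using 0 by (simp add: sum.reindex[OF inj_E])
    ultimately show "f x = 0"
      using triangular_scalars_zero[of S \<rho> E "\<lambda>l. f (E l)" l] fin inj diag tri by auto
  qed
qed

lemma independent_basis_w: "finite S \<Longrightarrow> cfun.independent (basis_w ` S)" 
  and inj_on_basis_w: "finite S \<Longrightarrow> inj_on basis_w S"
  using triangular_independent[of S "\<lambda>l. l" basis_w] by (auto simp: basis_w_apply)

lemma dim_supported: "finite S \<Longrightarrow> cfun.dim (supported S) = card S"
  by (simp add: supported_eq_span cfun.dim_eq_card_independent independent_basis_w
      card_image[OF inj_on_basis_w])

text \<open>The ambient space of all functions is infinite-dimensional, so the bound on independent sets has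
  to come from a basis of \<open>V\<close>, which is finite because \<open>S\<close> is.\<close>
lemma span_eq_if_card_eq_dim:
  fixes V :: "(nat \<Rightarrow> complex) set"
  assumes S: "finite S" "V \<subseteq> supported S" and V: "cfun.subspace V"
    and B: "B \<subseteq> V" "cfun.independent B" "finite B" "card B = cfun.dim V"
  shows "cfun.span B = V"
proof
  show "cfun.span B \<subseteq> V"
    using B V by (intro cfun.span_minimal)
  show "V \<subseteq> cfun.span B"
  proof
    fix v assume v: "v \<in> V"
    obtain B' where B': "B' \<subseteq> V" "cfun.independent B'" "V \<subseteq> cfun.span B'" "card B' = cfun.dim V"
      using cfun.basis_exists by blast
    have fin: "finite B'"
      using cfun.independent_span_bound[of "basis_w ` S" B'] S B' supported_eq_span[OF S(1)] by auto
    show "v \<in> cfun.span B"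
    proof (rule ccontr)
      assume nv: "v \<notin> cfun.span B"
      then have "cfun.independent (insert v B)"
        using B cfun.independent_insertI by blast
      moreover have "insert v B \<subseteq> cfun.span B'"
        using v B B' by auto
      ultimately have "card (insert v B) \<le> card B'"
        using cfun.independent_span_bound[OF fin] by blast
      moreover have "v \<notin> B"
        using nv cfun.span_base by blast
      ultimately show False
        using B B' by simp
    qed
  qed
qed

lemma dim_image_inj:
  assumes f: "clinear f" and "cfun.subspace V" and "inj_on f V"
  shows "cfun.dim (f ` V) = cfun.dim V"
proof -
  obtain B where B: "B \<subseteq> V" "cfun.independent B" "V \<subseteq> cfun.span B" "card B = cfun.dim V"
    using cfun.basis_exists by blast
  have span: "cfun.span B = V"
    using B assms(2) by (intro cfun.span_subspace)
  have "cfun.independent (f ` B)"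
    using cfun_pair.linear_independent_injective_image[OF f B(2)] span assms(3) by simp
  moreover have "cfun.span (f ` B) = f ` V"
    using cfun_pair.linear_span_image[OF f, of B] span by simp
  moreover have "card (f ` B) = card B"
    using B(1) assms(3) by (meson card_image inj_on_subset)
  ultimately show ?thesis
    using B(4) by (metis cfun.dim_eq_card_independent cfun.dim_span)
qed

lemma subspace_eq_if_dim_eq:
  fixes V :: "(nat \<Rightarrow> complex) set"
  assumes "finite S" "V \<subseteq> supported S" "cfun.subspace V"
    and "U \<subseteq> V" "cfun.subspace U" "cfun.dim U = cfun.dim V"
  shows "U = V"
proof -
  obtain B where B: "B \<subseteq> U" "cfun.independent B" "U \<subseteq> cfun.span B" "card B = cfun.dim U"
    using cfun.basis_exists by blast
  have "finite B"
    using cfun.independent_span_bound[of "basis_w ` S" B] B assms supported_eq_span[OF assms(1)] by auto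
  then have "cfun.span B = V"
    using B assms by (intro span_eq_if_card_eq_dim[OF assms(1,2,3)]) auto
  moreover have "cfun.span B = U"
    using B assms by (intro cfun.span_subspace)
  ultimately show ?thesis by simp
qed

lemma not_inj_on_if_card_less:
  assumes f: "clinear f" and "finite A" "finite B" "card B < card A"
    and img: "f ` supported A \<subseteq> supported B"
  shows "\<not> inj_on f (supported A)"
proof
  assume inj: "inj_on f (supported A)"
  have "cfun.dim (f ` supported A) = card A"
    using dim_image_inj[OF f subspace_supported inj] dim_supported assms by simp
  moreover have "cfun.dim (f ` supported A) \<le> card (basis_w ` B)"
    using img assms by (intro cfun.dim_le_card) (simp_all add: supported_eq_span)
  ultimately show False
    using assms card_image_le[of B basis_w] by simp
qed

definition combine :: "nat set \<Rightarrow> (nat \<Rightarrow> nat \<Rightarrow> complex) \<Rightarrow> (nat \<Rightarrow> complex) \<Rightarrow> nat \<Rightarrow> complex" where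
  "combine S E x = (\<Sum>l\<in>S. cscale (x l) (E l))"

lemma combine_apply: "combine S E x p = (\<Sum>l\<in>S. x l * E l p)"
  by (simp add: combine_def sum_fun_apply)

lemma clinear_combine: "clinear (combine S E)"
  by (rule clinearI)
    (simp_all add: combine_apply fun_eq_iff sum_distrib_left sum.distrib algebra_simps)

lemma combine_supported:
  assumes "\<And>l. l \<in> S \<Longrightarrow> E l \<in> supported R" shows "combine S E x \<in> supported R"
  unfolding combine_def using assms
  by (intro cfun.subspace_sum cfun.subspace_scale subspace_supported)

lemma combine_basis_w:
  assumes "finite S" shows "combine S E (basis_w l) = (if l \<in> S then E l else 0)"
  using assms by (simp add: fun_eq_iff combine_apply basis_w_apply if_distrib[of "\<lambda>c. c * _"] cong: if_cong)

text \<open>A matrix which is triangular with non-zero diagonal is invertible; \<open>E l\<close> is its column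
  of index \<open>l\<close>.\<close>
lemma triangular_bij_betw:
  fixes \<rho> :: "nat \<Rightarrow> nat" and E :: "nat \<Rightarrow> nat \<Rightarrow> complex"
  assumes fin: "finite S" and inj: "inj_on \<rho> S"
    and diag: "\<And>l. l \<in> S \<Longrightarrow> E l l \<noteq> 0"
    and tri: "\<And>l m. l \<in> S \<Longrightarrow> m \<in> S \<Longrightarrow> \<rho> l < \<rho> m \<Longrightarrow> E l m = 0"
    and supp: "\<And>l. l \<in> S \<Longrightarrow> E l \<in> supported S"
  shows "bij_betw (combine S E) (supported S) (supported S)"
proof -
  note lin = clinear_combine[of S E]
  have inj_f: "inj_on (combine S E) (supported S)"
    unfolding cfun_pair.linear_inj_on_iff_eq_0[OF lin subspace_supported]
  proof safe
    fix x assume x: "x \<in> supported S" "combine S E x = 0"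
    then have "x l = 0" for l
      using triangular_scalars_zero[of S \<rho> E x l] fin inj diag tri
      by (cases "l \<in> S") (auto simp: combine_def supported_def)
    then show "x = 0" by (simp add: fun_eq_iff)
  qed
  have "combine S E ` supported S \<subseteq> supported S"
    using supp combine_supported by blast
  moreover have "cfun.dim (combine S E ` supported S) = cfun.dim (supported S)"
    by (rule dim_image_inj[OF lin subspace_supported inj_f])
  ultimately have "combine S E ` supported S = supported S"
    using cfun_pair.linear_subspace_image[OF lin subspace_supported]
    by (intro subspace_eq_if_dim_eq[OF fin subset_refl]) (auto simp: subspace_supported)
  then show ?thesis
    using inj_f unfolding bij_betw_def by simp
qed

section \<open>Splitting W into a projective and an injective part\<close>

text \<open>With \<open>m = i\<close> this is the space of \<open>hat_P \<oplus> hat_I\<close> at the vertex \<open>i\<close>, and with \<open>m = d j\<close>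
  that of \<open>flag_P \<oplus> flag_I\<close> at the vertex \<open>j\<close>.\<close>
definition split_space :: "nat \<Rightarrow> nat \<Rightarrow> (nat + nat \<Rightarrow> complex) set" where
  "split_space n m = {v. v \<circ> Inl \<in> supported {1..m} \<and> v \<circ> Inr \<in> supported {m + 1..n + 1}}"

definition split_W :: "nat \<Rightarrow> nat \<Rightarrow> (nat \<Rightarrow> complex) \<Rightarrow> nat + nat \<Rightarrow> complex" where
  "split_W n m x = case_sum (proj_on {1..m} x) (proj_on {m + 1..n + 1} x)"

lemma clinear_to_W: "clinear to_W"
  by (rule clinearI) (simp_all add: to_W_def fun_eq_iff algebra_simps)

lemma clinear_split_W: "clinear (split_W n m)"
  by (rule clinearI) (auto simp: split_W_def fun_eq_iff proj_on_def split: sum.split)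

lemma split_W_in_split_space: "split_W n m x \<in> split_space n m"
  by (simp add: split_W_def split_space_def comp_def)

lemma to_W_split_W: "x \<in> space_W n \<Longrightarrow> to_W (split_W n m x) = x"
  by (auto simp: to_W_def split_W_def proj_on_def space_W_def fun_eq_iff)

lemma split_space_Inl: "v \<in> split_space n m \<Longrightarrow> v (Inl l) = proj_on {1..m} (to_W v) l"
  and split_space_Inr: "v \<in> split_space n m \<Longrightarrow> v (Inr l) = proj_on {m + 1..n + 1} (to_W v) l"
  by (auto simp: to_W_def split_space_def supported_def proj_on_def)

lemma split_W_to_W: "v \<in> split_space n m \<Longrightarrow> split_W n m (to_W v) = v"
  by (auto simp: fun_eq_iff split_W_def split_space_Inl split_space_Inr split: sum.split)

lemma to_W_in_space_W: "v \<in> split_space n m \<Longrightarrow> m \<le> n \<Longrightarrow> to_W v \<in> space_W n"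
  by (auto simp: to_W_def split_space_def supported_def space_W_def)

lemma to_W_subspaces:
  assumes "m \<le> n" and N: "N \<in> subspaces k (split_space n m)"
  shows "to_W ` N \<in> subspaces k (space_W n)"
proof -
  have "inj_on to_W N"
    using N split_W_to_W by (intro inj_on_inverseI[where g = "split_W n m"]) (auto simp: subspaces_def)
  then show ?thesis
    using N to_W_in_space_W assms(1) cfun_pair.linear_subspace_image[OF clinear_to_W]
      dim_image_inj[OF clinear_to_W, of N]
    by (auto simp: subspaces_def)
qed

lemma split_W_subspaces:
  assumes V: "V \<in> subspaces k (space_W n)"
  shows "split_W n m ` V \<in> subspaces k (split_space n m)"
proof -
  have "inj_on (split_W n m) V"
    using V to_W_split_W by (intro inj_on_inverseI[where g = to_W]) (auto simp: subspaces_def)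
  then show ?thesis
    using V split_W_in_split_space cfun_pair.linear_subspace_image[OF clinear_split_W]
      dim_image_inj[OF clinear_split_W, of V n m]
    by (auto simp: subspaces_def)
qed

lemma foldr_pr: "foldr pr [a + 1..<b + 1] x = proj_on (- {a + 1..b}) x"
proof (induction b arbitrary: x)
  case (Suc b)
  show ?case
  proof (cases "a \<le> b")
    case True
    then have "[a + 1..<Suc b + 1] = [a + 1..<b + 1] @ [Suc b]" by simp
    then have "foldr pr [a + 1..<Suc b + 1] x = proj_on (- {a + 1..b}) (pr (Suc b) x)"
      by (simp only: foldr_append Suc.IH) (simp add: Suc.IH[simplified])
    also have "\<dots> = proj_on (- {a + 1..Suc b}) x"
      using True by (auto simp: fun_eq_iff proj_on_def pr_def)
    finally show ?thesis .
  qed (auto simp: proj_on_def)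
qed (auto simp: proj_on_def)

section \<open>The two realizations of the degenerate flag variety\<close>

context
  fixes n s :: nat and d :: "nat \<Rightarrow> nat"
  assumes d_0: "d 0 = 0" and d_last: "d (s + 1) = n + 1"
    and d_less: "\<And>i. i \<le> s \<Longrightarrow> d i < d (i + 1)"
begin

lemma d_mono: "i \<le> j \<Longrightarrow> j \<le> s + 1 \<Longrightarrow> d i \<le> d j"
proof (induction rule: dec_induct)
  case (step k)
  then show ?case using d_less[of k] by simp
qed simp

lemma d_bounds: "i \<in> {1..s} \<Longrightarrow> d i \<in> {1..n}"
  using d_mono[of 1 i] d_less[of 0] d_0 d_mono[of "i + 1" "s + 1"] d_less[of i] d_last by auto

lemma block_le_iff:
  assumes "j \<le> s" "l \<le> n + 1"
  shows "block d l \<le> j \<longleftrightarrow> l \<le> d j"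
proof
  assume "l \<le> d j"
  then show "block d l \<le> j"
    unfolding block_def by (rule Least_le)
next
  assume "block d l \<le> j"
  moreover have "l \<le> d (block d l)"
    unfolding block_def using assms(2) d_last by (simp add: LeastI[of "\<lambda>i. l \<le> d i" "s + 1"])
  ultimately show "l \<le> d j"
    using d_mono[of "block d l" j] assms by linarith
qed

lemma space_flag_P:
  assumes j: "j \<in> {1..s}"
  shows "space (flag_P s d) j = supported {1..d j}"
proof -
  have le: "d j \<le> d s" "d s \<le> n"
    using j d_mono[of j s] d_bounds[of s] by auto
  have "v l \<in> space (proj_rep (block d l)) j \<longleftrightarrow> l \<le> d j \<or> v l = 0"
    if "l \<in> {1..d s}" for v :: "nat \<Rightarrow> complex" and l
    using block_le_iff[of j l] that le j by (simp add: proj_rep_def)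
  then have "v \<in> space (flag_P s d) j \<longleftrightarrow>
      (\<forall>l. (l \<in> {1..d s} \<longrightarrow> l \<le> d j \<or> v l = 0) \<and> (l \<notin> {1..d s} \<longrightarrow> v l = 0))" for v
    unfolding flag_P_def direct_sum_def by auto
  moreover have "(l \<in> {1..d s} \<longrightarrow> l \<le> d j \<or> v l = 0) \<and> (l \<notin> {1..d s} \<longrightarrow> v l = 0) \<longleftrightarrow>
      (l \<notin> {1..d j} \<longrightarrow> v l = 0)" for v :: "nat \<Rightarrow> complex" and l
    using le by auto
  ultimately show ?thesis
    unfolding supported_def by blast
qed

lemma space_flag_I:
  assumes j: "j \<in> {1..s}"
  shows "space (flag_I s d) j = supported {d j + 1..n + 1}"
proof -
  have le: "d 1 \<le> d j"
    using j d_mono[of 1 j] by auto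
  have "v l \<in> space (inj_rep (block d l - 1)) j \<longleftrightarrow> d j < l \<or> v l = 0"
    if "l \<in> {d 1 + 1..n + 1}" for v :: "nat \<Rightarrow> complex" and l
    using block_le_iff[of j l] that j by (auto simp: inj_rep_def)
  then have "v \<in> space (flag_I s d) j \<longleftrightarrow> (\<forall>l. (l \<in> {d 1 + 1..n + 1} \<longrightarrow> d j < l \<or> v l = 0) \<and>
      (l \<notin> {d 1 + 1..n + 1} \<longrightarrow> v l = 0))" for v
    unfolding flag_I_def direct_sum_def using d_last by auto
  moreover have "(l \<in> {d 1 + 1..n + 1} \<longrightarrow> d j < l \<or> v l = 0) \<and>
      (l \<notin> {d 1 + 1..n + 1} \<longrightarrow> v l = 0) \<longleftrightarrow> (l \<notin> {d j + 1..n + 1} \<longrightarrow> v l = 0)"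
    for v :: "nat \<Rightarrow> complex" and l
    using le by auto
  ultimately show ?thesis
    unfolding supported_def by blast
qed

lemma space_flag:
  "j \<in> {1..s} \<Longrightarrow> space (rep_plus (flag_P s d) (flag_I s d)) j = split_space n (d j)"
  by (simp add: rep_plus_def split_space_def space_flag_P space_flag_I)

lemma arrow_flag_Inl:
  assumes j: "j \<in> {1..<s}"
  shows "arrow (rep_plus (flag_P s d) (flag_I s d)) j v (Inl l) = (if l \<in> {1..d j} then v (Inl l) else 0)"
proof -
  have "d j \<le> d s" "d s \<le> n"
    using j d_mono[of j s] d_bounds[of s] by auto
  moreover from this have "block d l \<le> j \<longleftrightarrow> l \<le> d j" if "l \<in> {1..d s}"
    using block_le_iff[of j l] that j by simp
  ultimately show ?thesis
    by (auto simp: rep_plus_def flag_P_def direct_sum_def proj_rep_def)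
qed

lemma arrow_flag_Inr:
  assumes j: "j \<in> {1..<s}"
  shows "arrow (rep_plus (flag_P s d) (flag_I s d)) j v (Inr l) =
    (if l \<in> {d (j + 1) + 1..n + 1} then v (Inr l) else 0)"
proof -
  have "d 1 \<le> d (j + 1)"
    using j d_mono[of 1 "j + 1"] by auto
  moreover have "j + 1 \<le> block d l - 1 \<longleftrightarrow> d (j + 1) < l" if "l \<in> {d 1 + 1..n + 1}"
    using block_le_iff[of "j + 1" l] that j by auto
  ultimately show ?thesis
    using d_last by (auto simp: rep_plus_def flag_I_def direct_sum_def inj_rep_def)
qed

lemma arrow_flag_in_split_space:
  assumes j: "j \<in> {1..<s}"
  shows "arrow (rep_plus (flag_P s d) (flag_I s d)) j v \<in> split_space n (d (j + 1))"
  using d_mono[of j "j + 1"] j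
  by (auto simp: split_space_def supported_def arrow_flag_Inl[OF j] arrow_flag_Inr[OF j, simplified])

lemma to_W_arrow_flag:
  assumes j: "j \<in> {1..<s}" and v: "v \<in> split_space n (d j)"
  shows "to_W (arrow (rep_plus (flag_P s d) (flag_I s d)) j v) =
    foldr pr [d j + 1..<d (j + 1) + 1] (to_W v)"
proof
  fix l
  have le: "d j \<le> d (j + 1)"
    using j d_mono[of j "j + 1"] by auto
  have v0: "l \<notin> {1..d j} \<Longrightarrow> v (Inl l) = 0" "l \<notin> {d j + 1..n + 1} \<Longrightarrow> v (Inr l) = 0"
    using v by (auto simp: split_space_def supported_def)
  show "to_W (arrow (rep_plus (flag_P s d) (flag_I s d)) j v) l =
    foldr pr [d j + 1..<d (j + 1) + 1] (to_W v) l"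
    unfolding foldr_pr to_W_def proj_on_def arrow_flag_Inl[OF j] arrow_flag_Inr[OF j]
    using v0 le by auto
qed

lemma dim_vector_flag_P: "j \<in> {1..s} \<Longrightarrow> dim_vector (flag_P s d) j = d j"
  by (simp add: dim_vector_def space_flag_P dim_supported)

text \<open>At each vertex \<open>to_W\<close> is an isomorphism, which turns the arrows into composites of
  \<open>pr\<close>; hence it matches subrepresentations with flags.\<close>
lemma flag_grassmannian_eq: "flag_grassmannian s d = degenerate_flags n s d"
proof
  let ?M = "rep_plus (flag_P s d) (flag_I s d)"
  show "flag_grassmannian s d \<subseteq> degenerate_flags n s d"
  proof
    fix V assume "V \<in> flag_grassmannian s d"
    then obtain N where V: "V = (\<lambda>j\<in>{1..s}. to_W ` N j)"
      and N: "\<And>j. j \<in> {1..s} \<Longrightarrow> N j \<in> subspaces (d j) (split_space n (d j))"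
        "\<And>j. j \<in> {1..<s} \<Longrightarrow> arrow ?M j ` N j \<subseteq> N (j + 1)"
      by (auto simp: flag_grassmannian_def quiver_grassmannian_def dim_vector_flag_P space_flag PiE_def Pi_def)
    have "V j \<in> subspaces (d j) (space_W n)" if "j \<in> {1..s}" for j
      using to_W_subspaces[OF _ N(1)[OF that]] that d_bounds[OF that] by (simp add: V)
    moreover have "foldr pr [d j + 1..<d (j + 1) + 1] ` V j \<subseteq> V (j + 1)" if "j \<in> {1..<s}" for j
    proof -
      have "foldr pr [d j + 1..<d (j + 1) + 1] (to_W v) \<in> to_W ` N (j + 1)" if v: "v \<in> N j" for v
      proof -
        have "v \<in> split_space n (d j)"
          using N(1)[of j] \<open>j \<in> {1..<s}\<close> v by (auto simp: subspaces_def)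
        from to_W_arrow_flag[OF \<open>j \<in> {1..<s}\<close> this, symmetric] show ?thesis
          using N(2)[OF \<open>j \<in> {1..<s}\<close>] v by (simp only:) blast
      qed
      then show ?thesis
        using that by (simp add: V image_subset_iff del: upt_Suc)
    qed
    ultimately show "V \<in> degenerate_flags n s d"
      by (auto simp: degenerate_flags_def V)
  qed
  show "degenerate_flags n s d \<subseteq> flag_grassmannian s d"
  proof
    fix V assume V: "V \<in> degenerate_flags n s d"
    have V1: "V j \<in> subspaces (d j) (space_W n)" if "j \<in> {1..s}" for j
      using V that by (auto simp: degenerate_flags_def)
    have V2: "foldr pr [d j + 1..<d (j + 1) + 1] ` V j \<subseteq> V (j + 1)" if "j \<in> {1..<s}" for j
      using V that by (auto simp: degenerate_flags_def)
    define N where "N = (\<lambda>j\<in>{1..s}. split_W n (d j) ` V j)"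
    have "N j \<in> subspaces (d j) (split_space n (d j))" if "j \<in> {1..s}" for j
      using V1[OF that] that by (simp add: N_def split_W_subspaces)
    moreover have "arrow ?M j ` N j \<subseteq> N (j + 1)" if j: "j \<in> {1..<s}" for j
    proof -
      have "arrow ?M j (split_W n (d j) x) \<in> split_W n (d (j + 1)) ` V (j + 1)" if x: "x \<in> V j" for x
      proof -
        have j1: "j \<in> {1..s}" "j + 1 \<in> {1..s}" using j by auto
        have xW: "x \<in> space_W n"
          using V1[OF j1(1)] x by (auto simp: subspaces_def)
        have "arrow ?M j (split_W n (d j) x) \<in> split_space n (d (j + 1))"
          by (rule arrow_flag_in_split_space[OF j])
        then have "arrow ?M j (split_W n (d j) x) = split_W n (d (j + 1)) (to_W (arrow ?M j (split_W n (d j) x)))"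
          by (simp add: split_W_to_W)
        also have "\<dots> = split_W n (d (j + 1)) (foldr pr [d j + 1..<d (j + 1) + 1] x)"
          using to_W_arrow_flag[OF j split_W_in_split_space] to_W_split_W[OF xW] by simp
        finally show ?thesis
          using V2[OF j] x by blast
      qed
      then show ?thesis
        using j by (auto simp: N_def)
    qed
    ultimately have "N \<in> quiver_grassmannian s (dim_vector (flag_P s d)) ?M"
      unfolding quiver_grassmannian_def
      by (simp add: space_flag dim_vector_flag_P PiE_def Pi_def) (simp add: N_def)
    moreover have "V = (\<lambda>j\<in>{1..s}. to_W ` N j)"
    proof
      fix j
      show "V j = (\<lambda>j\<in>{1..s}. to_W ` N j) j"
      proof (cases "j \<in> {1..s}")
        case True
        have "to_W (split_W n (d j) x) = x" if "x \<in> V j" for x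
          using V1[OF True] that to_W_split_W[of x n] by (auto simp: subspaces_def)
        then have "to_W ` split_W n (d j) ` V j = V j"
          by (simp add: image_image)
        then show ?thesis using True by (simp add: N_def)
      next
        case False
        then show ?thesis
          using V by (auto simp: degenerate_flags_def PiE_def extensional_def)
      qed
    qed
    ultimately show "V \<in> flag_grassmannian s d"
      unfolding flag_grassmannian_def by blast
  qed
qed

end

section \<open>Cells\<close>

text \<open>The order \<open>d + 1 < \<dots> < n + 1 < 1 < \<dots> < d\<close>, for which \<open>cell n d L\<close> is a Schubert cell.\<close>
definition below :: "nat \<Rightarrow> nat \<Rightarrow> nat \<Rightarrow> bool" where
  "below d p l \<longleftrightarrow> (if l \<le> d then p < l \<or> d < p else d < p \<and> p < l)"

definition has_leading_term :: "nat \<Rightarrow> nat \<Rightarrow> (nat \<Rightarrow> complex) \<Rightarrow> bool" where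
  "has_leading_term d l e \<longleftrightarrow> e l = 1 \<and> (\<forall>p. e p \<noteq> 0 \<longrightarrow> p = l \<or> below d p l)"

lemma below_trans: "below d p l \<Longrightarrow> below d l m \<Longrightarrow> below d p m"
  and below_irrefl: "\<not> below d p p"
  by (auto simp: below_def split: if_splits)

lemma elt_bij_betw:
  assumes "finite L"
  shows "bij_betw (elt L) {1..card L} L"
proof -
  have "bij_betw (\<lambda>j. j - 1) {1..card L} {..<card L}"
    by (rule bij_betwI[where g = Suc]) auto
  moreover have "bij_betw ((!) (sorted_list_of_set L)) {..<card L} L"
    using bij_betw_nth[of "sorted_list_of_set L"] assms by simp
  ultimately show ?thesis
    unfolding elt_def by (rule bij_betw_trans[unfolded comp_def])
qed

lemma elt_mono:
  assumes "finite L" "1 \<le> i" "i \<le> j" "j \<le> card L"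
  shows "elt L i \<le> elt L j"
  using assms unfolding elt_def by (intro sorted_nth_mono) auto

lemma split_point_exists:
  fixes f :: "nat \<Rightarrow> nat"
  assumes "\<And>i j. 1 \<le> i \<Longrightarrow> i \<le> j \<Longrightarrow> j \<le> m \<Longrightarrow> f i \<le> f j"
  shows "\<exists>k\<le>m. (\<forall>j\<in>{1..k}. f j \<le> c) \<and> (\<forall>j\<in>{k + 1..m}. c < f j)"
  using assms
proof (induction m)
  case (Suc m)
  show ?case
  proof (cases "f (Suc m) \<le> c")
    case True
    then have "f j \<le> c" if "j \<in> {1..Suc m}" for j
      using Suc.prems[of j "Suc m"] that by auto
    then show ?thesis by (intro exI[of _ "Suc m"]) auto
  next
    case False
    obtain k where "k \<le> m" "\<forall>j\<in>{1..k}. f j \<le> c" "\<forall>j\<in>{k + 1..m}. c < f j"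
      using Suc by (meson le_SucI)
    then show ?thesis
      using False by (intro exI[of _ k]) (auto simp: le_Suc_eq)
  qed
qed simp

lemma has_leading_term_expansion_le:
  assumes "has_leading_term d l e" and "e \<in> space_W n" and "l \<le> d"
  shows "e = basis_w l + (\<Sum>p\<in>{1..<l}. cscale (e p) (basis_w p))
           + (\<Sum>p\<in>{d + 1..n + 1}. cscale (e p) (basis_w p))"
  using assms
  by (auto simp: fun_eq_iff sum_basis_w_apply basis_w_apply has_leading_term_def below_def space_W_def)

lemma has_leading_term_expansion_gt:
  assumes "has_leading_term d l e" and "d < l"
  shows "e = basis_w l + (\<Sum>p\<in>{d + 1..<l}. cscale (e p) (basis_w p))"
  using assms
  by (auto simp: fun_eq_iff sum_basis_w_apply basis_w_apply has_leading_term_def below_def)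

text \<open>The span of vectors with distinct leading terms has the right dimension, so a subspace in
  the cell is recognized by containing them, without a choice of a basis.\<close>
lemma cell_iff:
  assumes L: "L \<subseteq> {1..n + 1}" "card L = d"
  shows "V \<in> cell n d L \<longleftrightarrow>
    V \<in> subspaces d (space_W n) \<and> (\<forall>l\<in>L. \<exists>e\<in>V. has_leading_term d l e)"
proof
  have fin: "finite L" using L finite_subset by blast
  note bij = elt_bij_betw[OF fin, unfolded L(2)]
  {
    assume V: "V \<in> cell n d L"
    then obtain k e c where
      span: "cfun.span (e ` {1..d}) = V" and
      k: "k \<le> d" "\<And>j. j \<in> {1..k} \<Longrightarrow> elt L j \<le> d" "\<And>j. j \<in> {k + 1..d} \<Longrightarrow> d < elt L j" and
      e: "\<And>j. j \<in> {1..k} \<Longrightarrow> e j = basis_w (elt L j) + (\<Sum>p\<in>{1..<elt L j}. cscale (c j p) (basis_w p))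
                                  + (\<Sum>p\<in>{d + 1..n + 1}. cscale (c j p) (basis_w p))"
      "\<And>j. j \<in> {k + 1..d} \<Longrightarrow> e j = basis_w (elt L j) + (\<Sum>p\<in>{d + 1..<elt L j}. cscale (c j p) (basis_w p))"
      unfolding cell_def by blast
    have "\<exists>e\<in>V. has_leading_term d l e" if "l \<in> L" for l
    proof -
      obtain j where j: "j \<in> {1..d}" "l = elt L j"
        using bij \<open>l \<in> L\<close> unfolding bij_betw_def by (metis imageE)
      have "has_leading_term d l (e j)"
      proof (cases "j \<le> k")
        case True
        then show ?thesis
          using j e(1)[of j] k(2)[of j]
          by (auto simp: has_leading_term_def below_def sum_basis_w_apply basis_w_apply split: if_splits)
      next
        case False
        then show ?thesis
          using j e(2)[of j] k(3)[of j]
          by (auto simp: has_leading_term_def below_def sum_basis_w_apply basis_w_apply split: if_splits)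
      qed
      moreover have "e j \<in> V"
        using span j cfun.span_base[of "e j" "e ` {1..d}"] by auto
      ultimately show ?thesis by blast
    qed
    then show "V \<in> subspaces d (space_W n) \<and> (\<forall>l\<in>L. \<exists>e\<in>V. has_leading_term d l e)"
      using V by (auto simp: cell_def)
  }
  {
    assume "V \<in> subspaces d (space_W n) \<and> (\<forall>l\<in>L. \<exists>e\<in>V. has_leading_term d l e)"
    then have V: "V \<in> subspaces d (space_W n)" and "\<forall>l\<in>L. \<exists>e. e \<in> V \<and> has_leading_term d l e"
      by auto
    then obtain E where E: "\<And>l. l \<in> L \<Longrightarrow> E l \<in> V" "\<And>l. l \<in> L \<Longrightarrow> has_leading_term d l (E l)"
      by metis
    have EW: "E l \<in> space_W n" if "l \<in> L" for l
      using E(1)[OF that] V by (auto simp: subspaces_def)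
    obtain k where k: "k \<le> d" "\<forall>j\<in>{1..k}. elt L j \<le> d" "\<forall>j\<in>{k + 1..d}. d < elt L j"
      using split_point_exists[of d "elt L" d] elt_mono[OF fin] L(2) by blast
    (* The rank that puts the indices up to d after all the others, as in the order of the cell. *)
    define \<rho> where "\<rho> p = (if p \<le> d then p + (n + 1) else p)" for p
    have tri: "E l m = 0" if "l \<in> L" "m \<in> L" "\<rho> l < \<rho> m" for l m
      using E(2)[OF that(1)] that L(1) unfolding has_leading_term_def below_def \<rho>_def
      by (force split: if_splits)
    have inj: "inj_on \<rho> L"
    proof (rule inj_onI)
      fix l m assume "l \<in> L" "m \<in> L" "\<rho> l = \<rho> m"
      moreover from this have "l \<in> {1..n + 1}" "m \<in> {1..n + 1}"
        using L(1) by auto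
      ultimately show "l = m"
        by (auto simp: \<rho>_def split: if_splits)
    qed
    have diag: "E l l \<noteq> 0" if "l \<in> L" for l
      using E(2)[OF that] by (simp add: has_leading_term_def)
    have E_inj: "inj_on E L" and E_ind: "cfun.independent (E ` L)"
      using triangular_independent[of L \<rho> E] fin inj tri diag by blast+
    define e where "e = E \<circ> elt L"
    have e_image: "e ` {1..d} = E ` L"
      using bij by (metis bij_betw_imp_surj_on e_def image_comp)
    have mem: "elt L j \<in> L" if "j \<in> {1..d}" for j
      using bij that by (auto simp: bij_betw_def)
    have e_inj: "inj_on e {1..d}"
      using bij E_inj unfolding e_def by (intro comp_inj_on) (auto simp: bij_betw_def)
    have e_span: "cfun.span (e ` {1..d}) = V"
      unfolding e_image
      using V E E_ind fin L(2) card_image[OF E_inj]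
      by (intro span_eq_if_card_eq_dim[of "{1..n + 1}"]) (auto simp: subspaces_def space_W_supported)
    have 1: "e j = basis_w (elt L j) + (\<Sum>p\<in>{1..<elt L j}. cscale (e j p) (basis_w p))
        + (\<Sum>p\<in>{d + 1..n + 1}. cscale (e j p) (basis_w p))" if "j \<in> {1..k}" for j
      using has_leading_term_expansion_le[of d "elt L j" "e j" n] k that mem[of j] E(2) EW
      by (simp add: e_def)
    have 2: "e j = basis_w (elt L j) + (\<Sum>p\<in>{d + 1..<elt L j}. cscale (e j p) (basis_w p))"
      if "j \<in> {k + 1..d}" for j
      using has_leading_term_expansion_gt[of d "elt L j" "e j"] k that mem[of j] E(2)
      by (simp add: e_def)
    show "V \<in> cell n d L"
      unfolding cell_def
      using V k e_inj E_ind[folded e_image] e_span 1 2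
      by (intro CollectI conjI exI[of _ k] exI[of _ e] exI[of _ e]) blast+
  }
qed

section \<open>The action of the group\<close>

lemma space_hat_P: "i \<in> {1..n} \<Longrightarrow> space (hat_P n) i = supported {1..i}"
proof -
  assume i: "i \<in> {1..n}"
  have "v \<in> space (hat_P n) i \<longleftrightarrow>
      (\<forall>l. (l \<in> {1..n} \<longrightarrow> l \<le> i \<or> v l = 0) \<and> (l \<notin> {1..n} \<longrightarrow> v l = 0))" for v
    unfolding hat_P_def direct_sum_def proj_rep_def by auto
  moreover have "(l \<in> {1..n} \<longrightarrow> l \<le> i \<or> v l = 0) \<and> (l \<notin> {1..n} \<longrightarrow> v l = 0) \<longleftrightarrow>
      (l \<notin> {1..i} \<longrightarrow> v l = 0)" for v :: "nat \<Rightarrow> complex" and l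
    using i by auto
  ultimately show ?thesis
    unfolding supported_def by blast
qed

lemma space_hat_I: "i \<in> {1..n} \<Longrightarrow> space (hat_I n) i = supported {i + 1..n + 1}"
proof -
  assume i: "i \<in> {1..n}"
  have "v \<in> space (hat_I n) i \<longleftrightarrow>
      (\<forall>l. (l \<in> {2..n + 1} \<longrightarrow> i \<le> l - 1 \<or> v l = 0) \<and> (l \<notin> {2..n + 1} \<longrightarrow> v l = 0))" for v
    unfolding hat_I_def direct_sum_def inj_rep_def by auto
  moreover have "(l \<in> {2..n + 1} \<longrightarrow> i \<le> l - 1 \<or> v l = 0) \<and> (l \<notin> {2..n + 1} \<longrightarrow> v l = 0) \<longleftrightarrow>
      (l \<notin> {i + 1..n + 1} \<longrightarrow> v l = 0)" for v :: "nat \<Rightarrow> complex" and l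
    using i by auto
  ultimately show ?thesis
    unfolding supported_def by blast
qed

lemma arrow_hat_P:
  assumes "i \<in> {1..n}" "x \<in> supported {1..i}"
  shows "arrow (hat_P n) i x = x"
proof
  fix l
  have "l \<notin> {1..i} \<Longrightarrow> x l = 0"
    using assms(2) by (simp add: supported_def)
  then show "arrow (hat_P n) i x l = x l"
    using assms(1) by (auto simp: hat_P_def direct_sum_def proj_rep_def)
qed

lemma arrow_hat_I: "1 \<le> i \<Longrightarrow> arrow (hat_I n) i x = proj_on {i + 2..n + 1} x"
  by (auto simp: hat_I_def direct_sum_def inj_rep_def proj_on_def fun_eq_iff)

lemma space_hat: "i \<in> {1..n} \<Longrightarrow> space (rep_plus (hat_P n) (hat_I n)) i = split_space n i"
  by (simp add: rep_plus_def split_space_def space_hat_P space_hat_I)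

text \<open>The component at the vertex \<open>i\<close> of a group element, as a map on \<open>W\<close>. The projections make
  it linear on all functions, although \<open>a i\<close>, \<open>h i\<close> and \<open>b i\<close> need only be linear on the spaces of the
  representations.\<close>
definition act_map where
  "act_map n a h b i x =
    a i (proj_on {1..i} x) + (h i (proj_on {1..i} x) + b i (proj_on {i + 1..n + 1} x))"
  for a h b :: "nat \<Rightarrow> (nat \<Rightarrow> complex) \<Rightarrow> nat \<Rightarrow> complex"

lemma act_at_block_matrix:
  assumes i: "i \<in> {1..n}" and U: "U \<subseteq> space_W n"
  shows "act_at n (block_matrix a h b) i U = act_map n a h b i ` U"
proof -
  have "to_W (block_matrix a h b i v) = act_map n a h b i (to_W v)" if "v \<in> split_space n i" for v
  proof -
    have "v \<circ> Inl = proj_on {1..i} (to_W v)" "v \<circ> Inr = proj_on {i + 1..n + 1} (to_W v)"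
      using split_space_Inl[OF that] split_space_Inr[OF that] by auto
    moreover have "to_W (case_sum p q) = p + q" for p q :: "nat \<Rightarrow> complex"
      by (simp add: to_W_def fun_eq_iff)
    ultimately show ?thesis
      by (simp only: block_matrix_def act_map_def)
  qed
  then have "act_at n (block_matrix a h b) i U = act_map n a h b i ` to_W ` {v \<in> split_space n i. to_W v \<in> U}"
    unfolding act_at_def space_hat[OF i] image_image by (intro image_cong) auto
  moreover have "to_W ` {v \<in> split_space n i. to_W v \<in> U} = U"
  proof
    show "U \<subseteq> to_W ` {v \<in> split_space n i. to_W v \<in> U}"
    proof
      fix x assume "x \<in> U"
      then have "to_W (split_W n i x) = x"
        using U by (intro to_W_split_W) auto
      then show "x \<in> to_W ` {v \<in> split_space n i. to_W v \<in> U}"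
        using \<open>x \<in> U\<close> split_W_in_split_space[of n i x] by (metis (mono_tags, lifting) image_eqI mem_Collect_eq)
    qed
  qed auto
  ultimately show ?thesis by simp
qed

lemma rep_homD:
  assumes "f \<in> rep_hom n M N" and "i \<in> {1..n}" and "x \<in> space M i"
  shows "f i x \<in> space N i" and "y \<in> space M i \<Longrightarrow> f i (x + y) = f i x + f i y"
    and "f i (cscale c x) = cscale c (f i x)"
    and "i < n \<Longrightarrow> f (i + 1) (arrow M i x) = arrow N i (f i x)"
proof -
  have "f i \<in> space M i \<rightarrow> space N i \<and>
      (\<forall>u\<in>space M i. \<forall>v\<in>space M i. f i (u + v) = f i u + f i v) \<and>
      (\<forall>c. \<forall>v\<in>space M i. f i (cscale c v) = cscale c (f i v))"
    using assms(1,2) unfolding rep_hom_def by blast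
  then show "f i x \<in> space N i" "y \<in> space M i \<Longrightarrow> f i (x + y) = f i x + f i y"
    "f i (cscale c x) = cscale c (f i x)"
    using assms(3) by (auto simp: Pi_def)
  have "\<forall>j\<in>{1..<n}. \<forall>v\<in>space M j. f (j + 1) (arrow M j v) = arrow N j (f j v)"
    using assms(1) unfolding rep_hom_def by blast
  then show "i < n \<Longrightarrow> f (i + 1) (arrow M i x) = arrow N i (f i x)"
    using assms(2,3) by auto
qed

locale group_element =
  fixes n :: nat and a h b :: "nat \<Rightarrow> (nat \<Rightarrow> complex) \<Rightarrow> nat \<Rightarrow> complex"
  assumes a_aut: "a \<in> rep_aut n (hat_P n)"
    and h_hom: "h \<in> rep_hom n (hat_P n) (hat_I n)"
    and b_aut: "b \<in> rep_aut n (hat_I n)"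
begin

abbreviation T :: "nat \<Rightarrow> (nat \<Rightarrow> complex) \<Rightarrow> nat \<Rightarrow> complex" where
  "T \<equiv> act_map n a h b"

lemma a_hom: "a \<in> rep_hom n (hat_P n) (hat_P n)" and b_hom: "b \<in> rep_hom n (hat_I n) (hat_I n)"
  using a_aut b_aut by (simp_all add: rep_aut_def)

lemma a_supp: "i \<in> {1..n} \<Longrightarrow> x \<in> supported {1..i} \<Longrightarrow> a i x \<in> supported {1..i}"
  and h_supp: "i \<in> {1..n} \<Longrightarrow> x \<in> supported {1..i} \<Longrightarrow> h i x \<in> supported {i + 1..n + 1}"
  and b_supp: "i \<in> {1..n} \<Longrightarrow> x \<in> supported {i + 1..n + 1} \<Longrightarrow> b i x \<in> supported {i + 1..n + 1}"
  using rep_homD(1)[OF a_hom, of i x] rep_homD(1)[OF h_hom, of i x] rep_homD(1)[OF b_hom, of i x]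
  by (simp_all only: space_hat_P space_hat_I)

lemma a_linear:
  assumes "i \<in> {1..n}" "x \<in> supported {1..i}"
  shows "y \<in> supported {1..i} \<Longrightarrow> a i (x + y) = a i x + a i y" and "a i (cscale c x) = cscale c (a i x)"
  using rep_homD(2,3)[OF a_hom assms(1), of x] assms(2) by (simp_all only: space_hat_P[OF assms(1)])

lemma h_linear:
  assumes "i \<in> {1..n}" "x \<in> supported {1..i}"
  shows "y \<in> supported {1..i} \<Longrightarrow> h i (x + y) = h i x + h i y" and "h i (cscale c x) = cscale c (h i x)"
  using rep_homD(2,3)[OF h_hom assms(1), of x] assms(2) by (simp_all only: space_hat_P[OF assms(1)])

lemma b_linear:
  assumes "i \<in> {1..n}" "x \<in> supported {i + 1..n + 1}"
  shows "y \<in> supported {i + 1..n + 1} \<Longrightarrow> b i (x + y) = b i x + b i y" and "b i (cscale c x) = cscale c (b i x)"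
  using rep_homD(2,3)[OF b_hom assms(1), of x] assms(2) by (simp_all only: space_hat_I[OF assms(1)])

lemma a_0: "i \<in> {1..n} \<Longrightarrow> a i 0 = 0" and h_0: "i \<in> {1..n} \<Longrightarrow> h i 0 = 0" and b_0: "i \<in> {1..n} \<Longrightarrow> b i 0 = 0"
  using a_linear(2)[of i 0 0] h_linear(2)[of i 0 0] b_linear(2)[of i 0 0] zero_supported by simp_all

lemma a_arrow:
  assumes "i \<in> {1..<n}" "x \<in> supported {1..i}" shows "a (i + 1) x = a i x"
proof -
  have i: "i \<in> {1..n}" using assms by auto
  have "a (i + 1) (arrow (hat_P n) i x) = arrow (hat_P n) i (a i x)"
    using rep_homD(4)[OF a_hom i] assms space_hat_P[OF i] by simp
  then show ?thesis
    using arrow_hat_P[OF i] assms a_supp[OF i] by simp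
qed

lemma h_arrow:
  assumes "i \<in> {1..<n}" "x \<in> supported {1..i}" shows "h (i + 1) x = proj_on {i + 2..n + 1} (h i x)"
proof -
  have i: "i \<in> {1..n}" using assms by auto
  have "h (i + 1) (arrow (hat_P n) i x) = arrow (hat_I n) i (h i x)"
    using rep_homD(4)[OF h_hom i] assms space_hat_P[OF i] by simp
  then show ?thesis
    using arrow_hat_P[OF i] arrow_hat_I[of i n] assms by simp
qed

lemma b_arrow:
  assumes "i \<in> {1..<n}" "x \<in> supported {i + 1..n + 1}"
  shows "b (i + 1) (proj_on {i + 2..n + 1} x) = proj_on {i + 2..n + 1} (b i x)"
proof -
  have i: "i \<in> {1..n}" using assms by auto
  have "b (i + 1) (arrow (hat_I n) i x) = arrow (hat_I n) i (b i x)"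
    using rep_homD(4)[OF b_hom i] assms space_hat_I[OF i] by simp
  then show ?thesis
    using arrow_hat_I[of i n] assms by simp
qed

lemma clinear_T: "i \<in> {1..n} \<Longrightarrow> clinear (T i)"
proof (rule clinearI)
  assume i: "i \<in> {1..n}"
  show "T i (x + y) = T i x + T i y" for x y
    unfolding act_map_def proj_on_add
    using a_linear(1)[OF i, of "proj_on {1..i} x" "proj_on {1..i} y"]
      h_linear(1)[OF i, of "proj_on {1..i} x" "proj_on {1..i} y"]
      b_linear(1)[OF i, of "proj_on {i + 1..n + 1} x" "proj_on {i + 1..n + 1} y"] proj_on_supported
    by (simp add: algebra_simps)
  show "T i (cscale c x) = cscale c (T i x)" for c x
    unfolding act_map_def proj_on_cscale
    using a_linear(2)[OF i, of "proj_on {1..i} x" c]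
      h_linear(2)[OF i, of "proj_on {1..i} x" c]
      b_linear(2)[OF i, of "proj_on {i + 1..n + 1} x" c] proj_on_supported
    by (simp add: cfun.scale_right_distrib)
qed

lemma T_in_space_W:
  assumes i: "i \<in> {1..n}" shows "T i x \<in> space_W n"
  using a_supp[OF i, of "proj_on {1..i} x"] h_supp[OF i, of "proj_on {1..i} x"]
    b_supp[OF i, of "proj_on {i + 1..n + 1} x"] i proj_on_supported
  by (auto simp: act_map_def supported_def space_W_def)

lemma proj_on_T:
  assumes i: "i \<in> {1..n}"
  shows "proj_on {1..i} (T i x) = a i (proj_on {1..i} x)"
    and "proj_on {i + 1..n + 1} (T i x) = h i (proj_on {1..i} x) + b i (proj_on {i + 1..n + 1} x)"
  using a_supp[OF i, of "proj_on {1..i} x"] h_supp[OF i, of "proj_on {1..i} x"]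
    b_supp[OF i, of "proj_on {i + 1..n + 1} x"] i proj_on_supported
  by (auto simp: act_map_def supported_def proj_on_apply fun_eq_iff)

lemma T_inj:
  assumes i: "i \<in> {1..n}" shows "inj_on (T i) (space_W n)"
  unfolding space_W_supported cfun_pair.linear_inj_on_iff_eq_0[OF clinear_T[OF i] subspace_supported]
proof safe
  fix x assume x: "x \<in> supported {1..n + 1}" and 0: "T i x = 0"
  have inj: "inj_on (a i) (supported {1..i})" "inj_on (b i) (supported {i + 1..n + 1})"
  proof -
    have "bij_betw (a i) (space (hat_P n) i) (space (hat_P n) i)"
      "bij_betw (b i) (space (hat_I n) i) (space (hat_I n) i)"
      using a_aut b_aut i unfolding rep_aut_def by blast+
    then show "inj_on (a i) (supported {1..i})" "inj_on (b i) (supported {i + 1..n + 1})"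
      by (simp_all only: bij_betw_def space_hat_P[OF i] space_hat_I[OF i])
  qed
  have proj_0: "proj_on S 0 = 0" for S
    by (simp add: proj_on_def fun_eq_iff)
  have "a i (proj_on {1..i} x) = a i 0"
    using proj_on_T(1)[OF i, of x] 0 proj_0 a_0[OF i] by simp
  then have P: "proj_on {1..i} x = 0"
    using inj(1) zero_supported proj_on_supported by (meson inj_onD)
  then have "b i (proj_on {i + 1..n + 1} x) = b i 0"
    using proj_on_T(2)[OF i, of x] 0 proj_0 h_0[OF i] b_0[OF i] by simp
  then have I: "proj_on {i + 1..n + 1} x = 0"
    using inj(2) zero_supported proj_on_supported by (meson inj_onD)
  show "x = 0"
  proof
    fix l show "x l = 0 l"
      using fun_cong[OF P, of l] fun_cong[OF I, of l] x
      by (cases "l \<in> {1..n + 1}") (auto simp: proj_on_apply supported_def split: if_splits)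
  qed
qed

lemma T_arrow:
  assumes i: "i \<in> {1..<n}"
  shows "T (i + 1) (proj_on (- {i + 1}) x) = proj_on (- {i + 1}) (T i x)"
proof -
  have i': "i \<in> {1..n}" using i by auto
  define p where "p = proj_on {1..i} x"
  define q where "q = proj_on {i + 1..n + 1} x"
  have pq: "p \<in> supported {1..i}" "q \<in> supported {i + 1..n + 1}"
    by (simp_all add: p_def q_def)
  have e: "proj_on {1..i + 1} (proj_on (- {i + 1}) x) = p"
    "proj_on {i + 1 + 1..n + 1} (proj_on (- {i + 1}) x) = proj_on {i + 2..n + 1} q"
    by (auto simp: p_def q_def proj_on_def fun_eq_iff)
  have p1: "proj_on (- {i + 1}) y = y" if "y \<in> supported {1..i}" for y
    using that by (auto simp: supported_def proj_on_def fun_eq_iff)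
  have p2: "proj_on (- {i + 1}) y = proj_on {i + 2..n + 1} y" if "y \<in> supported {i + 1..n + 1}" for y
    using that by (auto simp: supported_def proj_on_def fun_eq_iff not_le less_Suc_eq)
  have "T (i + 1) (proj_on (- {i + 1}) x) = a i p + (proj_on {i + 2..n + 1} (h i p) + proj_on {i + 2..n + 1} (b i q))"
    unfolding act_map_def e using a_arrow[OF i pq(1)] h_arrow[OF i pq(1)] b_arrow[OF i pq(2)] by simp
  also have "\<dots> = proj_on (- {i + 1}) (a i p + (h i p + b i q))"
    unfolding proj_on_add
    using p1[OF a_supp[OF i' pq(1)]] p2[OF h_supp[OF i' pq(1)]] p2[OF b_supp[OF i' pq(2)]] by simp
  finally show ?thesis
    by (simp add: act_map_def p_def q_def)
qed

lemma T_proj_on: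
  assumes "i \<le> m" "1 \<le> i" "m \<le> n"
  shows "T m (proj_on (- {i + 1..m}) x) = proj_on (- {i + 1..m}) (T i x)"
  using assms
proof (induction m rule: dec_induct)
  case base
  then show ?case by (simp add: proj_on_def)
next
  case (step k)
  have e: "proj_on (- {i + 1..Suc k}) y = proj_on (- {k + 1}) (proj_on (- {i + 1..k}) y)" for y
    using step.hyps by (auto simp: proj_on_def fun_eq_iff)
  show ?case
    unfolding e using T_arrow[of k] step by simp
qed

text \<open>A vector supported in \<open>{1..j}\<close> comes from the vertex \<open>j\<close>, where its image is supported in
  \<open>{1..j}\<close> because the whole space is.\<close>
lemma a_triangular:
  assumes "j \<le> i" "1 \<le> j" "i \<le> n" "x \<in> supported {1..j}"
  shows "a i x \<in> supported {1..j}"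
  using assms
proof (induction i rule: dec_induct)
  case base
  then show ?case using a_supp[of j] by simp
next
  case (step k)
  then show ?case
    using a_arrow[of k x] supported_mono[of "{1..j}" "{1..k}"] by auto
qed

text \<open>For \<open>j \<le> n\<close> the vectors supported in \<open>{i + 1..j}\<close> are those that the path from \<open>i\<close> to \<open>j\<close>
  kills, and homomorphisms commute with paths.\<close>
lemma b_triangular:
  assumes i: "i \<in> {1..n}" and j: "i < j" "j \<le> n + 1" and x: "x \<in> supported {i + 1..j}"
  shows "b i x \<in> supported {i + 1..j}"
proof (cases "j = n + 1")
  case True
  then show ?thesis using b_supp[OF i] x by simp
next
  case False
  then have jn: "j \<in> {1..n}" using i j by auto
  have x': "x \<in> supported {i + 1..n + 1}"
    using x j supported_mono[of "{i + 1..j}" "{i + 1..n + 1}"] by auto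
  have p: "proj_on {1..i} x = 0" "proj_on (- {i + 1..j}) x = 0"
    using x by (auto simp: proj_on_def supported_def fun_eq_iff)
  have "T i x = b i x"
    using p(1) a_0[OF i] h_0[OF i] proj_on_eq_self[OF x' subset_refl] by (simp add: act_map_def)
  moreover have "T j 0 = 0"
    using cfun_pair.linear_0[OF clinear_T[OF jn]] .
  ultimately have "proj_on (- {i + 1..j}) (b i x) = 0"
    using T_proj_on[of i j x] i j jn p(2) by simp
  then have "b i x l = 0" if "l \<notin> {i + 1..j}" for l
    using that by (auto simp: proj_on_def fun_eq_iff split: if_splits)
  then show ?thesis
    by (auto simp: supported_def)
qed

lemma T_triangular:
  assumes i: "i \<in> {1..n}" and l: "l \<in> {1..n + 1}" and p: "T i (basis_w l) p \<noteq> 0"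
  shows "p = l \<or> below i p l"
proof (cases "l \<le> i")
  case True
  then have "proj_on {1..i} (basis_w l) = basis_w l" "proj_on {i + 1..n + 1} (basis_w l) = 0"
    using l by (auto simp: proj_on_def basis_w_def fun_eq_iff)
  then have "T i (basis_w l) = a i (basis_w l) + h i (basis_w l)"
    using b_0[OF i] by (simp add: act_map_def)
  moreover have "a i (basis_w l) \<in> supported {1..l}" "h i (basis_w l) \<in> supported {i + 1..n + 1}"
    using a_triangular[of l i "basis_w l"] h_supp[OF i, of "basis_w l"] True l i
    by (simp_all add: basis_w_supported)
  ultimately have "p \<in> {1..l} \<or> p \<in> {i + 1..n + 1}"
    using p unfolding supported_def by fastforce
  then show ?thesis
    using True by (auto simp: below_def)
next
  case False
  then have "proj_on {1..i} (basis_w l) = 0" "proj_on {i + 1..n + 1} (basis_w l) = basis_w l"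
    using l by (auto simp: proj_on_def basis_w_def fun_eq_iff)
  then have "T i (basis_w l) = b i (basis_w l)"
    using a_0[OF i] h_0[OF i] by (simp add: act_map_def)
  moreover have "b i (basis_w l) \<in> supported {i + 1..l}"
    using b_triangular[OF i, of l "basis_w l"] False l by (simp add: basis_w_supported)
  ultimately have "p \<in> {i + 1..l}"
    using p unfolding supported_def by fastforce
  then show ?thesis
    using False by (auto simp: below_def)
qed

text \<open>If the coefficient vanished, the span of the basis vectors up to \<open>l\<close>, in the order \<open>below i\<close>,
  would be mapped injectively into a space of one dimension less.\<close>
lemma T_diagonal:
  assumes i: "i \<in> {1..n}" and l: "l \<in> {1..n + 1}"
  shows "T i (basis_w l) l \<noteq> 0"
proof
  assume 0: "T i (basis_w l) l = 0"
  define B where "B = {p \<in> {1..n + 1}. below i p l}"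
  have fin: "finite B" "l \<notin> B"
    by (auto simp: B_def below_irrefl)
  have basis: "T i (basis_w m) \<in> supported B" if m: "m \<in> insert l B" for m
  proof -
    have "p \<in> B" if "T i (basis_w m) p \<noteq> 0" for p
    proof -
      have "p \<in> {1..n + 1}"
        using T_in_space_W[OF i, of "basis_w m"] that by (auto simp: space_W_def)
      moreover have "p = m \<or> below i p m"
        using T_triangular[OF i _ that] m l by (auto simp: B_def)
      ultimately show ?thesis
        using m that 0 below_trans[of i p m l] by (auto simp: B_def)
    qed
    then show ?thesis by (auto simp: supported_def)
  qed
  have "T i ` supported (insert l B) \<subseteq> supported B"
  proof safe
    fix x assume x: "x \<in> supported (insert l B)"
    have "T i x = T i (\<Sum>m\<in>insert l B. cscale (x m) (basis_w m))"
      using supported_expansion[OF _ x] fin(1) by simp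
    also have "\<dots> = (\<Sum>m\<in>insert l B. cscale (x m) (T i (basis_w m)))"
      by (simp only: cfun_pair.linear_sum[OF clinear_T[OF i]] cfun_pair.linear_scale[OF clinear_T[OF i]])
    also have "\<dots> \<in> supported B"
      using basis by (intro cfun.subspace_sum cfun.subspace_scale subspace_supported)
    finally show "T i x \<in> supported B" .
  qed
  then have "\<not> inj_on (T i) (supported (insert l B))"
    using fin by (intro not_inj_on_if_card_less[OF clinear_T[OF i]]) auto
  moreover have "supported (insert l B) \<subseteq> space_W n"
    unfolding space_W_supported using l by (intro supported_mono) (auto simp: B_def)
  ultimately show False
    using T_inj[OF i] inj_on_subset by blast
qed

lemma T_subspaces:
  assumes i: "i \<in> {1..n}" and V: "V \<in> subspaces k (space_W n)"
  shows "T i ` V \<in> subspaces k (space_W n)"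
  using V T_in_space_W[OF i] cfun_pair.linear_subspace_image[OF clinear_T[OF i]]
    dim_image_inj[OF clinear_T[OF i], of V] inj_on_subset[OF T_inj[OF i], of V]
  by (auto simp: subspaces_def)

lemma T_image_in_cell:
  assumes i: "i \<in> {1..n}" and L: "L \<subseteq> {1..n + 1}" "card L = i"
  shows "T i ` supported L \<in> cell n i L"
  unfolding cell_iff[OF L]
proof safe
  have "finite L" using L(1) finite_subset by blast
  then have "supported L \<in> subspaces i (space_W n)"
    using L supported_mono[OF L(1)] by (auto simp: subspaces_def subspace_supported dim_supported space_W_supported)
  then show "T i ` supported L \<in> subspaces i (space_W n)"
    by (rule T_subspaces[OF i])
  fix l assume l: "l \<in> L"
  define c where "c = T i (basis_w l) l"
  define e where "e = T i (cscale (1 / c) (basis_w l))"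
  have lL: "l \<in> {1..n + 1}" using l L by auto
  have e: "e = cscale (1 / c) (T i (basis_w l))"
    unfolding e_def by (rule cfun_pair.linear_scale[OF clinear_T[OF i]])
  have "c \<noteq> 0"
    using T_diagonal[OF i lL] by (simp add: c_def)
  then have "has_leading_term i l e"
    using T_triangular[OF i lL] by (auto simp: has_leading_term_def e c_def)
  moreover have "e \<in> T i ` supported L"
    unfolding e_def using l
    by (intro imageI cfun.subspace_scale subspace_supported basis_w_supported)
  ultimately show "\<exists>e\<in>T i ` supported L. has_leading_term i l e" by blast
qed

end

section \<open>Group elements with prescribed columns\<close>

lemma rep_homI:
  assumes "\<And>i x. i \<in> {1..n} \<Longrightarrow> x \<in> space M i \<Longrightarrow> f i x \<in> space N i"
    and "\<And>i. i \<in> {1..n} \<Longrightarrow> clinear (f i)"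
    and "\<And>i x. i \<in> {1..<n} \<Longrightarrow> x \<in> space M i \<Longrightarrow> f (i + 1) (arrow M i x) = arrow N i (f i x)"
  shows "f \<in> rep_hom n M N"
  using assms cfun_pair.linear_add[of "f _"] cfun_pair.linear_scale[of "f _"]
  unfolding rep_hom_def by (auto simp: Pi_def)

text \<open>A homomorphism on \<open>hat_P\<close> is determined by the images of the generators, and these can be
  prescribed: the generator of the summand \<open>l\<close>, at the vertex \<open>l\<close>, may go to any \<open>u l \<in> W\<close>, whose
  coordinates up to \<open>l\<close> belong to \<open>hat_P\<close> and the others to \<open>hat_I\<close>. At a later vertex \<open>i\<close> the
  coordinates \<open>l + 1, \<dots>, i\<close> of \<open>u l\<close> are lost. An endomorphism of \<open>hat_I\<close> is likewise given by
  columns \<open>v l\<close> supported in \<open>{..l}\<close>, of which the vertex \<open>i\<close> sees the coordinates above \<open>i\<close>.\<close>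
definition columns_a :: "(nat \<Rightarrow> nat \<Rightarrow> complex) \<Rightarrow> nat \<Rightarrow> (nat \<Rightarrow> complex) \<Rightarrow> nat \<Rightarrow> complex" where
  "columns_a u i = combine {1..i} (\<lambda>l. proj_on {1..l} (u l))"

definition columns_h :: "nat \<Rightarrow> (nat \<Rightarrow> nat \<Rightarrow> complex) \<Rightarrow> nat \<Rightarrow> (nat \<Rightarrow> complex) \<Rightarrow> nat \<Rightarrow> complex" where
  "columns_h n u i = combine {1..i} (\<lambda>l. proj_on {i + 1..n + 1} (u l))"

definition columns_b :: "nat \<Rightarrow> (nat \<Rightarrow> nat \<Rightarrow> complex) \<Rightarrow> nat \<Rightarrow> (nat \<Rightarrow> complex) \<Rightarrow> nat \<Rightarrow> complex" where
  "columns_b n v i = combine {i + 1..n + 1} (\<lambda>l. proj_on {i + 1..n + 1} (v l))"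

lemma combine_Suc:
  assumes "x \<in> supported {1..i}"
  shows "combine {1..i + 1} E x = combine {1..i} E x"
proof -
  have "x (Suc i) = 0"
    using assms by (simp add: supported_def)
  then show ?thesis
    by (simp add: fun_eq_iff combine_apply)
qed

lemma columns_a_aut:
  assumes diag: "\<And>l. l \<in> {1..n} \<Longrightarrow> u l l \<noteq> 0"
  shows "columns_a u \<in> rep_aut n (hat_P n)"
proof -
  have supp: "columns_a u i x \<in> supported {1..i}" for i x
    unfolding columns_a_def
    by (rule combine_supported) (meson atLeastatMost_subset_iff atLeastAtMost_iff order_refl
        proj_on_supported subsetD supported_mono)
  have hom: "columns_a u \<in> rep_hom n (hat_P n) (hat_P n)"
  proof (rule rep_homI)
    show "columns_a u i x \<in> space (hat_P n) i" if "i \<in> {1..n}" for i x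
      using supp by (simp add: space_hat_P[OF that])
    show "clinear (columns_a u i)" for i
      unfolding columns_a_def by (rule clinear_combine)
    show "columns_a u (i + 1) (arrow (hat_P n) i x) = arrow (hat_P n) i (columns_a u i x)"
      if i: "i \<in> {1..<n}" and x: "x \<in> space (hat_P n) i" for i x
    proof -
      have i': "i \<in> {1..n}" using i by auto
      have x': "x \<in> supported {1..i}" using x by (simp add: space_hat_P[OF i'])
      show ?thesis
        unfolding arrow_hat_P[OF i' x'] arrow_hat_P[OF i' supp]
        unfolding columns_a_def by (rule combine_Suc[OF x'])
    qed
  qed
  have "bij_betw (columns_a u i) (space (hat_P n) i) (space (hat_P n) i)" if i: "i \<in> {1..n}" for i
    unfolding columns_a_def space_hat_P[OF i]
  proof (rule triangular_bij_betw[where \<rho> = "\<lambda>l. l"])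
    fix l assume l: "l \<in> {1..i}"
    show "proj_on {1..l} (u l) l \<noteq> 0"
      using diag[of l] l i by (simp add: proj_on_apply)
    show "proj_on {1..l} (u l) \<in> supported {1..i}"
      using l by (auto simp: supported_def proj_on_apply)
    show "proj_on {1..l} (u l) m = 0" if "l < m" for m
      using that by (simp add: proj_on_apply)
  qed auto
  then show ?thesis
    using hom by (simp add: rep_aut_def)
qed

lemma columns_h_hom: "columns_h n u \<in> rep_hom n (hat_P n) (hat_I n)"
proof (rule rep_homI)
  show "columns_h n u i x \<in> space (hat_I n) i" if "i \<in> {1..n}" for i x
    unfolding space_hat_I[OF that] columns_h_def by (rule combine_supported) simp
  show "clinear (columns_h n u i)" for i
    unfolding columns_h_def by (rule clinear_combine)
  show "columns_h n u (i + 1) (arrow (hat_P n) i x) = arrow (hat_I n) i (columns_h n u i x)"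
    if i: "i \<in> {1..<n}" and x: "x \<in> space (hat_P n) i" for i x
  proof -
    have i': "i \<in> {1..n}" "1 \<le> i" using i by auto
    have x': "x \<in> supported {1..i}" using x by (simp add: space_hat_P[OF i'(1)])
    show ?thesis
      unfolding arrow_hat_P[OF i'(1) x'] arrow_hat_I[OF i'(2)] columns_h_def combine_Suc[OF x']
      by (auto simp: fun_eq_iff combine_apply proj_on_apply)
  qed
qed

lemma columns_b_aut:
  assumes diag: "\<And>l. l \<in> {2..n + 1} \<Longrightarrow> v l l \<noteq> 0"
    and tri: "\<And>l. l \<in> {2..n + 1} \<Longrightarrow> v l \<in> supported {..l}"
  shows "columns_b n v \<in> rep_aut n (hat_I n)"
proof -
  have hom: "columns_b n v \<in> rep_hom n (hat_I n) (hat_I n)"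
  proof (rule rep_homI)
    show "columns_b n v i x \<in> space (hat_I n) i" if "i \<in> {1..n}" for i x
      unfolding space_hat_I[OF that] columns_b_def by (rule combine_supported) simp
    show "clinear (columns_b n v i)" for i
      unfolding columns_b_def by (rule clinear_combine)
    show "columns_b n v (i + 1) (arrow (hat_I n) i x) = arrow (hat_I n) i (columns_b n v i x)"
      if i: "i \<in> {1..<n}" for i x
    proof
      fix p
      have i': "1 \<le> i" using i by auto
      (* The summand i + 1 of the right-hand side dies, since its column is supported in {..i + 1}. *)
      have "v (i + 1) p = 0" if "i + 2 \<le> p"
        using tri[of "i + 1"] i that by (auto simp: supported_def)
      moreover have "{i + 1..n + 1} = insert (i + 1) {i + 2..n + 1}"
        using i by auto
      ultimately show "columns_b n v (i + 1) (arrow (hat_I n) i x) p = arrow (hat_I n) i (columns_b n v i x) p"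
        unfolding arrow_hat_I[OF i']
        by (auto simp: columns_b_def combine_apply proj_on_apply intro!: sum.cong)
    qed
  qed
  have "bij_betw (columns_b n v i) (space (hat_I n) i) (space (hat_I n) i)" if i: "i \<in> {1..n}" for i
    unfolding columns_b_def space_hat_I[OF i]
  proof (rule triangular_bij_betw[where \<rho> = "\<lambda>l. l"])
    fix l assume l: "l \<in> {i + 1..n + 1}"
    then have l2: "l \<in> {2..n + 1}" using i by auto
    show "proj_on {i + 1..n + 1} (v l) l \<noteq> 0"
      using diag[OF l2] l by (simp add: proj_on_apply)
    show "proj_on {i + 1..n + 1} (v l) m = 0" if "l < m" for m
      using tri[OF l2] that by (simp add: proj_on_apply supported_def)
  qed auto
  then show ?thesis
    using hom by (simp add: rep_aut_def)
qed

lemma act_map_columns_le: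
  assumes i: "i \<in> {1..n}" and l: "l \<in> {1..i}" and u: "u l \<in> space_W n"
  shows "act_map n (columns_a u) (columns_h n u) (columns_b n v) i (basis_w l) = proj_on (- {l + 1..i}) (u l)"
proof -
  have e: "proj_on {1..i} (basis_w l) = basis_w l" "proj_on {i + 1..n + 1} (basis_w l) = 0"
    using l by (auto simp: proj_on_def basis_w_def fun_eq_iff)
  have z: "columns_b n v i 0 = 0"
    by (simp add: columns_b_def combine_apply fun_eq_iff)
  show ?thesis
    unfolding act_map_def e z
    using l i u by (auto simp: columns_a_def columns_h_def combine_basis_w fun_eq_iff proj_on_apply space_W_def)
qed

lemma act_map_columns_gt:
  assumes i: "i \<in> {1..n}" and l: "l \<in> {i + 1..n + 1}"
  shows "act_map n (columns_a u) (columns_h n u) (columns_b n v) i (basis_w l) = proj_on {i + 1..n + 1} (v l)"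
proof -
  have e: "proj_on {1..i} (basis_w l) = 0" "proj_on {i + 1..n + 1} (basis_w l) = basis_w l"
    using l i by (auto simp: proj_on_def basis_w_def fun_eq_iff)
  have z: "columns_a u i 0 = 0" "columns_h n u i 0 = 0"
    by (simp_all add: columns_a_def columns_h_def combine_apply fun_eq_iff)
  show ?thesis
    unfolding act_map_def e z
    using l by (auto simp: columns_b_def combine_basis_w)
qed

section \<open>Orbits\<close>

lemma degenerate_flags_proj_on:
  assumes V: "V \<in> degenerate_flags n s d" and d: "\<And>i. i \<in> {1..<s} \<Longrightarrow> d i \<le> d (i + 1)"
    and r: "1 \<le> r" "r \<le> t" "t \<le> s" and x: "x \<in> V r"
  shows "d r \<le> d t \<and> proj_on (- {d r + 1..d t}) x \<in> V t"
  using r(2,3)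
proof (induction t rule: dec_induct)
  case base
  then show ?case using x by (simp add: proj_on_def)
next
  case (step k)
  have k: "k \<in> {1..<s}" using step r by auto
  have IH: "d r \<le> d k" "proj_on (- {d r + 1..d k}) x \<in> V k"
    using step by auto
  have "foldr pr [d k + 1..<d (k + 1) + 1] ` V k \<subseteq> V (k + 1)"
    using V k by (simp add: degenerate_flags_def)
  then have "foldr pr [d k + 1..<d (k + 1) + 1] (proj_on (- {d r + 1..d k}) x) \<in> V (k + 1)"
    using IH(2) by blast
  then have "proj_on (- {d k + 1..d (k + 1)}) (proj_on (- {d r + 1..d k}) x) \<in> V (k + 1)"
    unfolding foldr_pr .
  moreover have "proj_on (- {d k + 1..d (k + 1)}) (proj_on (- {d r + 1..d k}) x) =
      proj_on (- {d r + 1..d (k + 1)}) x"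
    using IH(1) d[OF k] by (auto simp: proj_on_def fun_eq_iff)
  ultimately show ?case
    using IH(1) d[OF k] by simp
qed

text \<open>One column has to serve all the vertices. A vector with leading term \<open>l\<close> taken from the first
  \<open>V r\<close> that can provide it does: at a later vertex \<open>d t\<close> the column loses the same coordinates as
  the vector does on its way from \<open>V r\<close> to \<open>V t\<close>, except for \<open>l + 1, \<dots>, d r\<close>, where the vector is
  zero by the shape of the cell.\<close>
lemma projective_column_exists:
  assumes V: "V \<in> degenerate_flags n s d" and d: "\<And>i. i \<in> {1..<s} \<Longrightarrow> d i \<le> d (i + 1)"
    and lead: "\<And>t l. t \<in> {1..s} \<Longrightarrow> l \<in> L t \<Longrightarrow> \<exists>e\<in>V t. has_leading_term (d t) l e"
    and l: "l \<in> {1..n}"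
  shows "\<exists>u\<in>space_W n. u l = 1 \<and>
    (\<forall>t\<in>{1..s}. l \<in> L t \<and> l \<le> d t \<longrightarrow> proj_on (- {l + 1..d t}) u \<in> V t)"
proof (cases "\<exists>t. t \<in> {1..s} \<and> l \<in> L t \<and> l \<le> d t")
  case False
  then show ?thesis
    using l by (intro bexI[of _ "basis_w l"]) (auto simp: basis_w_def space_W_def)
next
  case True
  define r where "r = (LEAST t. t \<in> {1..s} \<and> l \<in> L t \<and> l \<le> d t)"
  have r: "r \<in> {1..s}" "l \<in> L r" "l \<le> d r"
    using LeastI_ex[OF True] by (auto simp: r_def)
  have least: "r \<le> t" if "t \<in> {1..s}" "l \<in> L t" "l \<le> d t" for t
    unfolding r_def using that by (intro Least_le) auto
  obtain e where e: "e \<in> V r" "has_leading_term (d r) l e"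
    using lead r by blast
  have "e \<in> space_W n"
    using V r(1) e(1) by (auto simp: degenerate_flags_def subspaces_def)
  moreover have "proj_on (- {l + 1..d t}) e \<in> V t" if t: "t \<in> {1..s}" "l \<in> L t" "l \<le> d t" for t
  proof -
    have *: "d r \<le> d t \<and> proj_on (- {d r + 1..d t}) e \<in> V t"
      using degenerate_flags_proj_on[OF V d, of r t e] least[OF t] t r e(1) by simp
    have e0: "e p = 0" if "p \<in> {l + 1..d r}" for p
      using e(2) that r(3) by (auto simp: has_leading_term_def below_def)
    have "proj_on (- {l + 1..d t}) e p = proj_on (- {d r + 1..d t}) e p" for p
      using e0[of p] r(3) by (auto simp: proj_on_apply)
    then show ?thesis
      using * by presburger
  qed
  ultimately show ?thesis
    using e(2) by (intro bexI[of _ e]) (auto simp: has_leading_term_def)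
qed

text \<open>The same choice works for the columns of the injective part: now the vector is zero outside
  \<open>{d r + 1..l}\<close>, so that keeping the coordinates above \<open>d t\<close> amounts to losing those in
  \<open>{d r + 1..d t}\<close>.\<close>
lemma injective_column_exists:
  assumes V: "V \<in> degenerate_flags n s d" and d: "\<And>i. i \<in> {1..<s} \<Longrightarrow> d i \<le> d (i + 1)"
    and lead: "\<And>t l. t \<in> {1..s} \<Longrightarrow> l \<in> L t \<Longrightarrow> \<exists>e\<in>V t. has_leading_term (d t) l e"
  shows "\<exists>v\<in>supported {..l}. v l = 1 \<and>
    (\<forall>t\<in>{1..s}. l \<in> L t \<and> d t < l \<longrightarrow> proj_on {d t + 1..n + 1} v \<in> V t)"
proof (cases "\<exists>t. t \<in> {1..s} \<and> l \<in> L t \<and> d t < l")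
  case False
  then show ?thesis
    by (intro bexI[of _ "basis_w l"]) (auto simp: basis_w_def supported_def)
next
  case True
  define r where "r = (LEAST t. t \<in> {1..s} \<and> l \<in> L t \<and> d t < l)"
  have r: "r \<in> {1..s}" "l \<in> L r" "d r < l"
    using LeastI_ex[OF True] by (auto simp: r_def)
  have least: "r \<le> t" if "t \<in> {1..s}" "l \<in> L t" "d t < l" for t
    unfolding r_def using that by (intro Least_le) auto
  obtain e where e: "e \<in> V r" "has_leading_term (d r) l e"
    using lead r by blast
  have eW: "e \<in> space_W n"
    using V r(1) e(1) by (auto simp: degenerate_flags_def subspaces_def)
  have e0: "e p = 0" if "p \<notin> {d r + 1..l}" for p
    using e(2) that r(3) by (auto simp: has_leading_term_def below_def)
  have "proj_on {d t + 1..n + 1} e \<in> V t" if t: "t \<in> {1..s}" "l \<in> L t" "d t < l" for t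
  proof -
    have *: "d r \<le> d t \<and> proj_on (- {d r + 1..d t}) e \<in> V t"
      using degenerate_flags_proj_on[OF V d, of r t e] least[OF t] t r e(1) by simp
    have "e p = 0" if "p \<notin> {1..n + 1}" for p
      using eW that by (auto simp: space_W_def)
    then have "proj_on {d t + 1..n + 1} e p = proj_on (- {d r + 1..d t}) e p" for p
      using e0[of p] * by (auto simp: proj_on_apply)
    then show ?thesis
      using * by presburger
  qed
  then show ?thesis
    using e(2) e0 by (intro bexI[of _ e]) (auto simp: has_leading_term_def supported_def)
qed

theorem theorem7p11:
  fixes n s :: nat and d :: "nat \<Rightarrow> nat" and L :: "nat \<Rightarrow> nat set"
  assumes "d 0 = 0" and "d (s + 1) = n + 1" and "\<And>i. i \<le> s \<Longrightarrow> d i < d (i + 1)"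
    and "\<And>i. i \<in> {1..s} \<Longrightarrow> L i \<subseteq> {1..n + 1} \<and> card (L i) = d i"
    and "fixed_point s L \<in> degenerate_flags n s d"
  shows "orbit n s d (fixed_point s L) =
           flag_grassmannian s d \<inter> (\<Pi>\<^sub>E i\<in>{1..s}. cell n (d i) (L i)) \<and>
         orbit n s d (fixed_point s L) =
           degenerate_flags n s d \<inter> (\<Pi>\<^sub>E i\<in>{1..s}. cell n (d i) (L i))"
proof -
  have d_bounds: "d t \<in> {1..n}" if "t \<in> {1..s}" for t
    using assms(1-3) that by (rule d_bounds)
  have d_le: "d i \<le> d (i + 1)" if "i \<in> {1..<s}" for i
    using assms(3)[of i] that by simp
  have L: "L t \<subseteq> {1..n + 1}" "card (L t) = d t" "finite (L t)" if "t \<in> {1..s}" for t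
    using assms(4)[OF that] finite_subset by auto
  have p: "fixed_point s L t = supported (L t)" if "t \<in> {1..s}" for t
    using that L(3)[OF that] by (simp add: fixed_point_def coord_subspace_def supported_eq_span)
  have p_W: "supported (L t) \<subseteq> space_W n" if "t \<in> {1..s}" for t
    unfolding space_W_supported by (rule supported_mono[OF L(1)[OF that]])
  have act: "(\<lambda>i\<in>{1..s}. act_at n (block_matrix a h b) (d i) (fixed_point s L i)) =
      (\<lambda>i\<in>{1..s}. act_map n a h b (d i) ` supported (L i))" for a h b
    using act_at_block_matrix[OF d_bounds p_W] by (intro restrict_ext) (simp add: p)
  let ?C = "degenerate_flags n s d \<inter> (\<Pi>\<^sub>E i\<in>{1..s}. cell n (d i) (L i))"
  have "orbit n s d (fixed_point s L) \<subseteq> ?C"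
  proof
    fix V assume "V \<in> orbit n s d (fixed_point s L)"
    then obtain a h b where abh: "a \<in> rep_aut n (hat_P n)" "h \<in> rep_hom n (hat_P n) (hat_I n)"
        "b \<in> rep_aut n (hat_I n)"
      and V: "V = (\<lambda>i\<in>{1..s}. act_map n a h b (d i) ` supported (L i))"
      unfolding orbit_def group_G_def using act by auto
    interpret group_element n a h b
      by unfold_locales (fact abh)+
    have cells: "V t \<in> cell n (d t) (L t)" if "t \<in> {1..s}" for t
      using T_image_in_cell[OF d_bounds[OF that] L(1,2)[OF that]] that by (simp add: V)
    have "foldr pr [d t + 1..<d (t + 1) + 1] x \<in> V (t + 1)" if t: "t \<in> {1..<s}" and x: "x \<in> V t" for t x
    proof -
      have t': "t \<in> {1..s}" "t + 1 \<in> {1..s}" using t by auto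
      obtain y where y: "y \<in> supported (L t)" "x = T (d t) y"
        using x t' by (auto simp: V)
      have "foldr pr [d t + 1..<d (t + 1) + 1] y \<in> supported (L (t + 1))"
        using assms(5) t y(1) p[OF t'(1)] p[OF t'(2)] unfolding degenerate_flags_def by blast
      moreover have "foldr pr [d t + 1..<d (t + 1) + 1] x =
          T (d (t + 1)) (foldr pr [d t + 1..<d (t + 1) + 1] y)"
        unfolding foldr_pr y(2)
        using T_proj_on[of "d t" "d (t + 1)" y] d_le[OF t] d_bounds[OF t'(1)] d_bounds[OF t'(2)] by simp
      ultimately show ?thesis
        using t' by (simp only: V restrict_apply if_True image_eqI)
    qed
    moreover have "V t \<in> subspaces (d t) (space_W n)" if "t \<in> {1..s}" for t
      using cells[OF that] by (simp add: cell_def)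
    moreover have "V \<in> extensional {1..s}"
      by (simp add: V)
    ultimately show "V \<in> ?C"
      using cells unfolding degenerate_flags_def PiE_def by blast
  qed
  moreover have "?C \<subseteq> orbit n s d (fixed_point s L)"
  proof
    fix V assume V: "V \<in> ?C"
    then have flag: "V \<in> degenerate_flags n s d" by blast
    have cell: "V t \<in> cell n (d t) (L t)" if "t \<in> {1..s}" for t
      using V that by (auto simp: PiE_def)
    have lead: "\<exists>e\<in>V t. has_leading_term (d t) l e" if "t \<in> {1..s}" "l \<in> L t" for t l
      using cell[OF that(1)] cell_iff[OF L(1,2)[OF that(1)]] that by blast
    have "\<forall>l\<in>{1..n}. \<exists>u. u \<in> space_W n \<and> u l = 1 \<and>
        (\<forall>t\<in>{1..s}. l \<in> L t \<and> l \<le> d t \<longrightarrow> proj_on (- {l + 1..d t}) u \<in> V t)"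
      using projective_column_exists[OF flag d_le lead] by blast
    then obtain u where u: "\<And>l. l \<in> {1..n} \<Longrightarrow> u l \<in> space_W n \<and> u l l = 1 \<and>
        (\<forall>t\<in>{1..s}. l \<in> L t \<and> l \<le> d t \<longrightarrow> proj_on (- {l + 1..d t}) (u l) \<in> V t)"
      by metis
    have "\<forall>l. \<exists>v. v \<in> supported {..l} \<and> v l = 1 \<and>
        (\<forall>t\<in>{1..s}. l \<in> L t \<and> d t < l \<longrightarrow> proj_on {d t + 1..n + 1} v \<in> V t)"
      using injective_column_exists[OF flag d_le lead] by blast
    then obtain v where v: "\<And>l. v l \<in> supported {..l} \<and> v l l = 1 \<and>
        (\<forall>t\<in>{1..s}. l \<in> L t \<and> d t < l \<longrightarrow> proj_on {d t + 1..n + 1} (v l) \<in> V t)"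
      by metis
    define a where "a = columns_a u"
    define h where "h = columns_h n u"
    define b where "b = columns_b n v"
    interpret group_element n a h b
      unfolding a_def h_def b_def
      by unfold_locales (use u v in \<open>auto intro!: columns_a_aut columns_h_hom columns_b_aut\<close>)
    have "T (d t) ` supported (L t) = V t" if t: "t \<in> {1..s}" for t
    proof -
      have dt: "d t \<in> {1..n}" by (rule d_bounds[OF t])
      have Vt: "V t \<subseteq> space_W n" "cfun.subspace (V t)" "cfun.dim (V t) = d t"
        using cell[OF t] by (auto simp: cell_def subspaces_def)
      have "T (d t) (basis_w l) \<in> V t" if l: "l \<in> L t" for l
      proof (cases "l \<le> d t")
        case True
        then have "l \<in> {1..d t}" "l \<in> {1..n}"
          using L(1)[OF t] l dt by auto
        then show ?thesis
          using act_map_columns_le[OF dt, of l u v] u[of l] t l True by (simp add: a_def h_def b_def)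
      next
        case False
        then have "l \<in> {d t + 1..n + 1}"
          using L(1)[OF t] l by auto
        then show ?thesis
          using act_map_columns_gt[OF dt, of l u v] v[of l] t l False by (simp add: a_def h_def b_def)
      qed
      then have sub: "T (d t) ` supported (L t) \<subseteq> V t"
        unfolding supported_eq_span[OF L(3)[OF t]] cfun_pair.linear_span_image[OF clinear_T[OF dt], symmetric]
        by (intro cfun.span_minimal Vt) auto
      have "T (d t) ` supported (L t) \<in> subspaces (d t) (space_W n)"
        using T_image_in_cell[OF dt L(1,2)[OF t]] by (simp add: cell_def)
      then show ?thesis
        using sub Vt by (intro subspace_eq_if_dim_eq[of "{1..n + 1}"])
          (auto simp: subspaces_def space_W_supported)
    qed
    then have "V = (\<lambda>i\<in>{1..s}. T (d i) ` supported (L i))"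
      using V by (intro extensionalityI[of _ "{1..s}"]) (auto simp: PiE_def)
    then have "V = (\<lambda>i\<in>{1..s}. act_at n (block_matrix a h b) (d i) (fixed_point s L i))"
      by (simp only: act)
    moreover have "block_matrix a h b \<in> group_G n"
      unfolding group_G_def using a_aut h_hom b_aut by blast
    ultimately show "V \<in> orbit n s d (fixed_point s L)"
      unfolding orbit_def by blast
  qed
  ultimately have "orbit n s d (fixed_point s L) = ?C"
    by (rule subset_antisym)
  moreover have "flag_grassmannian s d = degenerate_flags n s d"
    using assms(1-3) by (rule flag_grassmannian_eq)
  ultimately show ?thesis by simp
qed

end
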